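(* Let $m,n$ be nonnegative integers with $n\ge m+1$ and let $\varphi\in\mathcal{LP}_m$. If $\mathbf{s},\mathbf{t}\in l^\infty$ are such that $\mathbf{s}\leqslant\mathbf{t}$, then $\mathcal{D}(\varphi^{\mathbf{s}},n)[P]\preccurlyeq\mathcal{D}(\varphi^{\mathbf{t}},n)[P]$ in $\mathcal{H}_{n-m}$ for every $P\in\mathcal{H}_n$.
   Context: $\mathcal{H}_n$ denotes the set of monic univariate polynomials of degree $n$ all of whose zeros are real; $\mathcal{Z}(P)$ is the unordered tuple of zeros of $P$ counted with multiplicity. Spectral order: for unordered real $n$-tuples $X,Y$ write $X\prec Y$ if $\sum_{i=1}^n f(x_i)\le\sum_{i=1}^n f(y_i)$ for every convex $f:\mathbb{R}\to\mathbb{R}$ (equivalently, $X=AY$ as column vectors for some doubly stochastic matrix $A$); for $P,Q\in\mathcal{H}_n$ write $Q\preccurlyeq P$ if $\mathcal{Z}(Q)\prec\mathcal{Z}(P)$. The Laguerre-Pólya class $\mathcal{LP}$ is the set of real entire functions of the form $\varphi(x)=cx^me^{-a^2x^2+bx}\prod_{k=1}^\infty(1-\alpha_kx)e^{\alpha_kx}$ with $a,b,c,\alpha_k\in\mathbb{R}$, $c\ne0$, $m$ a nonnegative integer and $\sum_k\alpha_k^2<\infty$. $\mathcal{LP}_m$ is the set of $\varphi\in\mathcal{LP}$ having a zero of order exactly $m$ at $0$. With $D=d/dx$ and $\varphi(x)=\sum_k a_kx^k$, put $\varphi(D)[P]=\sum_k a_kP^{(k)}$ for polynomials $P$. For $\varphi\in\mathcal{LP}_m$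 and $n\ge m+1$, $\mathcal{D}(\varphi,n)=\left[\binom{n}{m}\varphi^{(m)}(0)\right]^{-1}\varphi(D)$, which maps $\mathcal{H}_n$ into $\mathcal{H}_{n-m}$ (by a classical theorem of Pólya). $l^\infty$ is the space of bounded real sequences $\mathbf{s}=\{s_i\}_{i=0}^\infty$, partially ordered by: $\mathbf{s}\leqslant\mathbf{t}$ iff $|s_i|\le|t_i|$ and $s_it_i\ge0$ for all $i\ge0$. For $\varphi\in\mathcal{LP}_m$ written as $\varphi(x)=cx^me^{-a^2x^2+bx}\prod_{k=1}^\infty(1-\alpha_kx)e^{\alpha_kx}$ with $a,b,c,\alpha_k\in\mathbb{R}$, $c\ne0$ and $\sum_k\alpha_k^2<\infty$ (with one fixed choice of the parameters $a,b,c$ and of the sequence $(\alpha_k)_{k\ge1}$, used for all deformations of $\varphi$) and $\mathbf{s}\in l^\infty$, the $\mathbf{s}$-deformation of $\varphi$ is $\varphi^{\mathbf{s}}(x)=cx^me^{-s_0^2a^2x^2+bx}\prod_{k=1}^\infty(1-s_k\alpha_kx)e^{s_k\alpha_kx}\in\mathcal{LP}_m$. *)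

theory Defs
  imports
    "HOL-Complex_Analysis.Complex_Analysis"
    "HOL-Computational_Algebra.Computational_Algebra"
begin

definition hyp_polys :: "nat \<Rightarrow> real poly set" where
  "hyp_polys n = {P. degree P = n \<and> lead_coeff P = 1 \<and>
     (\<forall>z::complex. poly (map_poly complex_of_real P) z = 0 \<longrightarrow> z \<in> \<real>)}"

text \<open>Unordered real tuples are finite multisets; only tuples of the same length are compared.\<close>

definition spectral_le :: "real multiset \<Rightarrow> real multiset \<Rightarrow> bool" where
  "spectral_le X Y \<longleftrightarrow> size X = size Y \<and>
     (\<forall>f. convex_on UNIV f \<longrightarrow> (\<Sum>x\<in>#X. f x) \<le> (\<Sum>y\<in>#Y. f y))"

text \<open>The order on \<^term>\<open>hyp_polys n\<close>; both polynomials are required to lie in that set.\<close>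

definition poly_spectral_le :: "nat \<Rightarrow> real poly \<Rightarrow> real poly \<Rightarrow> bool" where
  "poly_spectral_le n Q P \<longleftrightarrow> Q \<in> hyp_polys n \<and> P \<in> hyp_polys n \<and>
     spectral_le (proots Q) (proots P)"

text \<open>Zero parameters are indexed from 1, so \<open>\<alpha> 0\<close> is never used; this leaves index 0 of a
  deforming sequence for the Gaussian factor.\<close>

definition lp_fun ::
  "nat \<Rightarrow> real \<Rightarrow> real \<Rightarrow> real \<Rightarrow> (nat \<Rightarrow> real) \<Rightarrow> complex \<Rightarrow> complex" where
  "lp_fun m a b c \<alpha> x =
     of_real c * x ^ m * exp (- of_real (a\<^sup>2) * x\<^sup>2 + of_real b * x) *
     (\<Prod>k. (1 - of_real (\<alpha> (Suc k)) * x) * exp (of_real (\<alpha> (Suc k)) * x))"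

definition lp_rep ::
  "nat \<Rightarrow> real \<Rightarrow> real \<Rightarrow> real \<Rightarrow> (nat \<Rightarrow> real) \<Rightarrow> (complex \<Rightarrow> complex) \<Rightarrow> bool" where
  "lp_rep m a b c \<alpha> \<phi> \<longleftrightarrow>
     c \<noteq> 0 \<and> summable (\<lambda>k. (\<alpha> (Suc k))\<^sup>2) \<and> \<phi> = lp_fun m a b c \<alpha>"

definition LP :: "(complex \<Rightarrow> complex) set" where
  "LP = {\<phi>. \<exists>m a b c \<alpha>. lp_rep m a b c \<alpha> \<phi>}"

definition LP_ord :: "nat \<Rightarrow> (complex \<Rightarrow> complex) set" where
  "LP_ord m = {\<phi> \<in> LP. zorder \<phi> 0 = int m}"

text \<open>The deformation depends on the chosen parameters, not only on the function they represent.\<close>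

definition lp_deform ::
  "(nat \<Rightarrow> real) \<Rightarrow> nat \<Rightarrow> real \<Rightarrow> real \<Rightarrow> real \<Rightarrow> (nat \<Rightarrow> real) \<Rightarrow> complex \<Rightarrow> complex" where
  "lp_deform s m a b c \<alpha> = lp_fun m (s 0 * a) b c (\<lambda>k. s k * \<alpha> k)"

text \<open>The Taylor coefficients at 0 of a real entire function are real, so taking real parts only
  converts their type. Derivatives of order above \<^term>\<open>degree P\<close> vanish, which makes the
  sum finite.\<close>

definition diff_op :: "(complex \<Rightarrow> complex) \<Rightarrow> real poly \<Rightarrow> real poly" where
  "diff_op \<phi> P =
     (\<Sum>k\<le>degree P. smult (Re (fps_nth (fps_expansion \<phi> 0) k)) ((pderiv ^^ k) P))"

text \<open>The first argument is the order of the zero of \<open>\<phi>\<close> at 0.\<close>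

definition norm_diff_op ::
  "nat \<Rightarrow> (complex \<Rightarrow> complex) \<Rightarrow> nat \<Rightarrow> real poly \<Rightarrow> real poly" where
  "norm_diff_op m \<phi> n P =
     smult (inverse (of_nat (n choose m) * Re ((deriv ^^ m) \<phi> 0))) (diff_op \<phi> P)"

definition seq_le :: "(nat \<Rightarrow> real) \<Rightarrow> (nat \<Rightarrow> real) \<Rightarrow> bool" where
  "seq_le s t \<longleftrightarrow> (\<forall>i. \<bar>s i\<bar> \<le> \<bar>t i\<bar> \<and> s i * t i \<ge> 0)"

end

(*
  A single factor (1 - aD) e^{aD} sends the monic polynomial with zeros q_1, ..., q_d to the
  characteristic polynomial of A_a = diag(q) + a (J - I), where J is the all-ones matrix. If
  a = theta b with 0 <= theta <= 1, then A_a = (1 - theta) diag(A_b) + theta A_b. Passing to the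
  diagonal averages conjugates of A_b by sign matrices, so the eigenvalues of A_a are majorized by
  those of A_b. All operators phi(D) commute and preserve real-rootedness, hence factors can be
  changed one at a time. The Gaussian factor is the limit of (1 - a^2 D^2/N)^N, a product of pairs
  of single factors with opposite signs, and the spectral order is closed under coefficientwise
  limits.
*)

theory Submission
  imports Defs
begin

section \<open>Real-rooted polynomials and the spectral order\<close>

text \<open>The matrix diag(q) + a J is never formed as an object. By the matrix determinant lemma
  its characteristic polynomial is Q - a Q', where Q has the zeros q, and the translation exp(a D)
  lowers every eigenvalue by a. That shift is exactly what makes the diagonal of A_a equal to q for
  every a, so that only the off-diagonal part scales with a. For distinct q_j and nonzero a, the
  secular equation sum_j 1/(mu - q_j) = 1/a makes the eigenvectors explicit, and the averaging over
  sign matrices is condensed into one explicit doubly stochastic matrix relating the two spectra.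

  The price is the restriction to distinct zeros and nonzero a. Closedness under limits therefore
  serves four times: for repeated zeros, for theta = 0, for the Gaussian and for the infinite
  product. Coefficientwise convergence is enough each time, because an operator acting on degree n
  sees only the Taylor coefficients up to n; for the same reason the infinite product is studied
  only near 0.\<close>

definition root_poly :: "nat \<Rightarrow> (nat \<Rightarrow> real) \<Rightarrow> real poly" where
  "root_poly n r = (\<Prod>i<n. [:- r i, 1:])"

lemma poly_root_poly: "poly (root_poly n r) x = (\<Prod>i<n. (x - r i))"
  by (simp add: root_poly_def poly_prod)

lemma monic_root_poly: "lead_coeff (root_poly n r) = 1"
  by (simp add: root_poly_def lead_coeff_prod)

lemma degree_root_poly: "degree (root_poly n r) = n"
  by (simp add: root_poly_def degree_prod_sum_eq)

lemma root_poly_nz [simp]: "root_poly n r \<noteq> 0"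
  using monic_root_poly[of n r] by auto

lemma proots_root_poly: "proots (root_poly n r) = image_mset r (mset_set {..<n})"
  unfolding root_poly_def by (subst proots_prod) (auto simp: sum_unfold_sum_mset)

lemma map_poly_of_real_mult:
  "map_poly complex_of_real (p * q) = map_poly complex_of_real p * map_poly complex_of_real q"
  by (intro poly_eqI) (simp add: coeff_map_poly coeff_mult)

lemma map_poly_of_real_smult:
  "map_poly complex_of_real (smult a q) = smult (of_real a) (map_poly complex_of_real q)"
  by (intro poly_eqI) (simp add: coeff_map_poly)

lemma map_poly_of_real_diff:
  "map_poly complex_of_real (p - q) = map_poly complex_of_real p - map_poly complex_of_real q"
  by (intro poly_eqI) (simp add: coeff_map_poly)

lemma map_poly_of_real_pderiv:
  "map_poly complex_of_real (pderiv p) = pderiv (map_poly complex_of_real p)"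
  by (intro poly_eqI) (simp add: coeff_map_poly coeff_pderiv)

lemma map_poly_of_real_root_poly:
  "map_poly complex_of_real (root_poly n r) = (\<Prod>i<n. [:- of_real (r i), 1:])"
  by (induction n) (simp_all add: root_poly_def map_poly_of_real_mult map_poly_pCons
      del: mult_pCons_left mult_pCons_right)

lemma poly_map_poly_of_real:
  "poly (map_poly complex_of_real p) (of_real x) = of_real (poly p x)"
  by (induction p) (simp_all add: map_poly_pCons)

lemma root_poly_in_hyp_polys: "root_poly n r \<in> hyp_polys n"
proof -
  have "z \<in> \<real>" if "poly (map_poly complex_of_real (root_poly n r)) z = 0" for z
    using that by (auto simp: map_poly_of_real_root_poly poly_prod)
  then show ?thesis
    by (simp add: hyp_polys_def degree_root_poly monic_root_poly[unfolded degree_root_poly])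
qed

lemma root_poly_Suc: "root_poly (Suc n) r = [:- r n, 1:] * root_poly n r"
  by (simp add: root_poly_def mult.commute)

lemma root_poly_cong: "(\<And>i. i < n \<Longrightarrow> r i = s i) \<Longrightarrow> root_poly n r = root_poly n s"
  by (simp add: root_poly_def)

text \<open>The fundamental theorem of algebra supplies a zero, which is real by hypothesis, and the
  quotient by its linear factor is again monic and real-rooted. The resulting enumeration of zeros
  is arbitrary, which is harmless because the order sees only multisets.\<close>

lemma hyp_polys_imp_root_poly:
  assumes "P \<in> hyp_polys n"
  shows "\<exists>r. P = root_poly n r"
  using assms
proof (induction n arbitrary: P)
  case 0
  then show ?case
    by (auto simp: hyp_polys_def root_poly_def elim: degree_eq_zeroE)
next
  case (Suc n)
  let ?c = "map_poly complex_of_real"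
  have P: "degree P = Suc n" "lead_coeff P = 1" "\<And>z. poly (?c P) z = 0 \<Longrightarrow> z \<in> \<real>"
    using Suc.prems by (auto simp: hyp_polys_def)
  have "degree (?c P) = Suc n"
    using P(1) by (subst degree_map_poly) auto
  then obtain z where z: "poly (?c P) z = 0"
    using fundamental_theorem_of_algebra[of "?c P"] by (auto simp: constant_degree)
  then obtain x where x: "z = of_real x" using P(3) by (auto elim: Reals_cases)
  have "of_real (poly P x) = (0::complex)"
    using z unfolding x poly_map_poly_of_real .
  then have "poly P x = 0" by simp
  then obtain Q where Q: "P = [:- x, 1:] * Q"
    by (auto simp: poly_eq_0_iff_dvd)
  have "Q \<noteq> 0" using Q P(1) by auto
  have "degree Q = n" using P(1) \<open>Q \<noteq> 0\<close> unfolding Q by (subst (asm) degree_mult_eq) auto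
  moreover have "lead_coeff Q = 1" using P(2) unfolding Q lead_coeff_mult by simp
  moreover have "w \<in> \<real>" if "poly (?c Q) w = 0" for w
    by (rule P(3)) (simp only: Q map_poly_of_real_mult poly_mult that mult_zero_right)
  ultimately obtain r where r: "Q = root_poly n r"
    using Suc.IH[of Q] by (auto simp: hyp_polys_def)
  have "P = root_poly (Suc n) (r(n := x))"
    unfolding root_poly_Suc Q r using root_poly_cong[of n r "r(n := x)"] by simp
  then show ?case by blast
qed

lemma poly_spectral_le_root_poly:
  "poly_spectral_le n (root_poly n x) (root_poly n y) \<longleftrightarrow>
     (\<forall>f. convex_on UNIV f \<longrightarrow> (\<Sum>i<n. f (x i)) \<le> (\<Sum>i<n. f (y i)))"
proof -
  have *: "(\<Sum>z\<in>#image_mset r (mset_set {..<n}). f z) = (\<Sum>i<n. f (r i))"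
    for r and f :: "real \<Rightarrow> real"
    by (simp add: image_mset.compositionality comp_def sum_unfold_sum_mset)
  show ?thesis
    unfolding poly_spectral_le_def spectral_le_def proots_root_poly *
    by (simp add: root_poly_in_hyp_polys)
qed

lemma poly_spectral_leE:
  assumes "poly_spectral_le n P Q"
  obtains x y where "P = root_poly n x" "Q = root_poly n y"
    "\<And>f. convex_on UNIV f \<Longrightarrow> (\<Sum>i<n. f (x i)) \<le> (\<Sum>i<n. f (y i))"
proof -
  obtain x y where "P = root_poly n x" "Q = root_poly n y"
    using assms hyp_polys_imp_root_poly by (metis poly_spectral_le_def)
  then show ?thesis using assms that by (simp add: poly_spectral_le_root_poly)
qed

lemma poly_spectral_le_refl: "P \<in> hyp_polys n \<Longrightarrow> poly_spectral_le n P P"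
  by (simp add: poly_spectral_le_def spectral_le_def)

lemma poly_spectral_le_trans:
  "poly_spectral_le n P Q \<Longrightarrow> poly_spectral_le n Q R \<Longrightarrow> poly_spectral_le n P R"
  by (force simp: poly_spectral_le_def spectral_le_def)

section \<open>Closedness of the spectral order\<close>

text \<open>A Cauchy bound: for |x| > 1, isolate x^n and divide by |x|^(n-1); the summand 1 covers
  |x| \<le> 1. It makes convergent coefficients force bounded zeros.\<close>

lemma monic_root_bound:
  fixes P :: "real poly"
  assumes "degree P = n" "lead_coeff P = 1" "poly P x = 0"
  shows "\<bar>x\<bar> \<le> 1 + (\<Sum>i<n. \<bar>coeff P i\<bar>)"
proof (cases "\<bar>x\<bar> \<le> 1 \<or> n = 0")
  case True
  have "n \<noteq> 0"
  proof
    assume "n = 0"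
    with assms show False by (auto elim!: degree_eq_zeroE)
  qed
  with True show ?thesis by (smt (verit) sum_nonneg abs_ge_zero)
next
  case False
  then have x: "\<bar>x\<bar> > 1" and n: "n > 0" by auto
  have "0 = (\<Sum>i\<le>n. coeff P i * x ^ i)" using assms by (simp add: poly_altdef)
  also have "\<dots> = (\<Sum>i<n. coeff P i * x ^ i) + x ^ n"
    using assms by (simp add: lessThan_Suc_atMost[symmetric])
  finally have "\<bar>x\<bar> ^ n = \<bar>\<Sum>i<n. coeff P i * x ^ i\<bar>"
    by (simp add: power_abs[symmetric] add_eq_0_iff)
  also have "\<dots> \<le> (\<Sum>i<n. \<bar>coeff P i\<bar> * \<bar>x\<bar> ^ i)"
    by (rule order_trans[OF sum_abs]) (simp add: abs_mult power_abs)
  also have "\<dots> \<le> (\<Sum>i<n. \<bar>coeff P i\<bar> * \<bar>x\<bar> ^ (n - 1))"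
    using x by (intro sum_mono mult_left_mono power_increasing) auto
  also have "\<dots> = (\<Sum>i<n. \<bar>coeff P i\<bar>) * \<bar>x\<bar> ^ (n - 1)"
    by (simp add: sum_distrib_right)
  finally have "\<bar>x\<bar> * \<bar>x\<bar> ^ (n - 1) \<le> (\<Sum>i<n. \<bar>coeff P i\<bar>) * \<bar>x\<bar> ^ (n - 1)"
    using n by (metis power_minus_mult mult.commute)
  then have "\<bar>x\<bar> \<le> (\<Sum>i<n. \<bar>coeff P i\<bar>)"
    by (rule mult_right_le_imp_le) (use x in \<open>auto intro!: zero_less_power\<close>)
  then show ?thesis by simp
qed

text \<open>Bolzano-Weierstrass, one coordinate at a time with nested subsequences.\<close>

lemma Bseq_family_convergent_subseq:
  fixes r :: "nat \<Rightarrow> nat \<Rightarrow> real"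
  assumes "\<And>i. i < n \<Longrightarrow> Bseq (\<lambda>k. r k i)"
  shows "\<exists>\<sigma> l. strict_mono (\<sigma> :: nat \<Rightarrow> nat) \<and> (\<forall>i<n. (\<lambda>k. r (\<sigma> k) i) \<longlonglongrightarrow> l i)"
  using assms
proof (induction n)
  case 0
  show ?case by (auto intro!: exI[of _ id] strict_mono_id)
next
  case (Suc n)
  then obtain \<sigma> l where s: "strict_mono (\<sigma> :: nat \<Rightarrow> nat)" "\<And>i. i < n \<Longrightarrow> (\<lambda>k. r (\<sigma> k) i) \<longlonglongrightarrow> l i"
    by force
  have "Bseq (\<lambda>k. r (\<sigma> k) n)"
    using Bseq_subseq[OF Suc.prems[of n], of \<sigma>] by simp
  then obtain u \<tau> where t: "strict_mono (\<tau> :: nat \<Rightarrow> nat)" "((\<lambda>k. r (\<sigma> k) n) \<circ> \<tau>) \<longlonglongrightarrow> u"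
    using bounded_imp_convergent_subsequence[of "\<lambda>k. r (\<sigma> k) n"] by (auto simp: Bseq_eq_bounded)
  have "(\<lambda>k. r ((\<sigma> \<circ> \<tau>) k) i) \<longlonglongrightarrow> (l(n := u)) i" if "i < Suc n" for i
  proof (cases "i = n")
    case True
    then show ?thesis using t(2) by (simp add: o_def)
  next
    case False
    with that have "i < n" by simp
    from LIMSEQ_subseq_LIMSEQ[OF s(2)[OF this] t(1)] False show ?thesis by (simp add: o_def)
  qed
  moreover have "strict_mono (\<sigma> \<circ> \<tau>)" using s(1) t(1) by (rule strict_mono_o)
  ultimately show ?case by blast
qed

definition coeff_tendsto :: "(nat \<Rightarrow> real poly) \<Rightarrow> real poly \<Rightarrow> bool" where
  "coeff_tendsto A B \<longleftrightarrow> (\<forall>i. (\<lambda>k. coeff (A k) i) \<longlonglongrightarrow> coeff B i)"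

lemma coeff_tendsto_const: "coeff_tendsto (\<lambda>_. P) P"
  by (simp add: coeff_tendsto_def)

lemma coeff_tendsto_degree_le:
  assumes "coeff_tendsto A B" "\<And>k. degree (A k) \<le> n"
  shows "degree B \<le> n"
proof (rule degree_le, intro allI impI)
  fix i assume "i > n"
  then have "coeff (A k) i = 0" for k using assms(2)[of k] by (intro coeff_eq_0) auto
  then have "(\<lambda>k. coeff (A k) i) = (\<lambda>k. 0)" by blast
  with assms(1) have "(\<lambda>k. 0) \<longlonglongrightarrow> coeff B i" by (metis coeff_tendsto_def)
  then show "coeff B i = 0" using LIMSEQ_unique tendsto_const by metis
qed

lemma poly_eq_sum_le: "degree p \<le> n \<Longrightarrow> poly p x = (\<Sum>i\<le>n. coeff p i * x ^ i)" for p :: "real poly"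
  unfolding poly_altdef by (rule sum.mono_neutral_left) (auto simp: coeff_eq_0)

lemma coeff_tendsto_poly:
  assumes "coeff_tendsto A B" "\<And>k. degree (A k) \<le> n"
  shows "(\<lambda>k. poly (A k) x) \<longlonglongrightarrow> poly B x"
  using assms(1)
  by (auto simp: poly_eq_sum_le[OF assms(2)] poly_eq_sum_le[OF coeff_tendsto_degree_le[OF assms]]
      coeff_tendsto_def intro!: tendsto_intros)

lemma coeff_tendsto_subseq:
  "coeff_tendsto A B \<Longrightarrow> strict_mono \<sigma> \<Longrightarrow> coeff_tendsto (\<lambda>k. A (\<sigma> k)) B"
  using LIMSEQ_subseq_LIMSEQ[of "\<lambda>k. coeff (A k) _" _ \<sigma>] by (auto simp: coeff_tendsto_def o_def)

lemma coeff_tendsto_root_poly_Bseq: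
  assumes "coeff_tendsto (\<lambda>k. root_poly n (r k)) B" "i < n"
  shows "Bseq (\<lambda>k. r k i)"
proof -
  note lead = monic_root_poly[of n, unfolded degree_root_poly]
  have "(\<lambda>k. 1 + (\<Sum>j<n. \<bar>coeff (root_poly n (r k)) j\<bar>)) \<longlonglongrightarrow> 1 + (\<Sum>j<n. \<bar>coeff B j\<bar>)"
    using assms(1) by (auto simp: coeff_tendsto_def intro!: tendsto_intros)
  then have "Bseq (\<lambda>k. 1 + (\<Sum>j<n. \<bar>coeff (root_poly n (r k)) j\<bar>))"
    by (intro convergent_imp_Bseq) (auto simp: convergent_def)
  moreover have "\<bar>r k i\<bar> \<le> 1 + (\<Sum>j<n. \<bar>coeff (root_poly n (r k)) j\<bar>)" for k
    by (rule monic_root_bound)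
       (use assms(2) in \<open>auto simp: degree_root_poly poly_root_poly lead\<close>)
  ultimately show ?thesis
    by (elim Bseq_eventually_mono[rotated]) (auto intro!: always_eventually order_trans[OF _ abs_ge_self])
qed

lemma coeff_tendsto_root_poly_unique:
  assumes "coeff_tendsto (\<lambda>k. root_poly n (r k)) B" "\<And>i. i < n \<Longrightarrow> (\<lambda>k. r k i) \<longlonglongrightarrow> l i"
  shows "B = root_poly n l"
proof -
  have "poly B x = poly (root_poly n l) x" for x
  proof (rule LIMSEQ_unique)
    show "(\<lambda>k. poly (root_poly n (r k)) x) \<longlonglongrightarrow> poly B x"
      by (rule coeff_tendsto_poly[OF assms(1), of n]) (simp add: degree_root_poly)
    show "(\<lambda>k. poly (root_poly n (r k)) x) \<longlonglongrightarrow> poly (root_poly n l) x"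
      unfolding poly_root_poly using assms(2) by (intro tendsto_intros) auto
  qed
  then show ?thesis by (simp add: poly_eq_poly_eq_iff[symmetric] fun_eq_iff)
qed

text \<open>Compactness gives a common subsequence along which the chosen zeros of both sides
  converge; their limits are the zeros of the limit polynomials, which also shows that these are
  real-rooted. Convex functions on the line are continuous, so the inequalities pass to the
  limit.\<close>

lemma poly_spectral_le_limit:
  assumes "\<And>k. poly_spectral_le n (A k) (B k)" "coeff_tendsto A A'" "coeff_tendsto B B'"
  shows "poly_spectral_le n A' B'"
proof -
  have "\<exists>x y. A k = root_poly n x \<and> B k = root_poly n y \<and>
      (\<forall>f. convex_on UNIV f \<longrightarrow> (\<Sum>i<n. f (x i)) \<le> (\<Sum>i<n. f (y i)))" for k
    using poly_spectral_leE[OF assms(1)[of k]] by metis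
  then obtain x y where xy: "\<And>k. A k = root_poly n (x k)" "\<And>k. B k = root_poly n (y k)"
    "\<And>k f. convex_on UNIV f \<Longrightarrow> (\<Sum>i<n. f (x k i)) \<le> (\<Sum>i<n. f (y k i))" by metis
  have A: "coeff_tendsto (\<lambda>k. root_poly n (x k)) A'" and B: "coeff_tendsto (\<lambda>k. root_poly n (y k)) B'"
    using assms(2,3) xy(1,2) by (simp_all add: coeff_tendsto_def)
  obtain \<sigma> l where s: "strict_mono (\<sigma> :: nat \<Rightarrow> nat)" "\<And>i. i < n \<Longrightarrow> (\<lambda>k. x (\<sigma> k) i) \<longlonglongrightarrow> l i"
    using Bseq_family_convergent_subseq[of n x] coeff_tendsto_root_poly_Bseq[OF A] by blast
  note B' = coeff_tendsto_subseq[OF B s(1)]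
  obtain \<tau> w where t: "strict_mono (\<tau> :: nat \<Rightarrow> nat)" "\<And>i. i < n \<Longrightarrow> (\<lambda>k. y (\<sigma> (\<tau> k)) i) \<longlonglongrightarrow> w i"
    using Bseq_family_convergent_subseq[of n "\<lambda>k. y (\<sigma> k)"] coeff_tendsto_root_poly_Bseq[OF B'] by blast
  have s': "(\<lambda>k. x (\<sigma> (\<tau> k)) i) \<longlonglongrightarrow> l i" if "i < n" for i
    using LIMSEQ_subseq_LIMSEQ[OF s(2)[OF that] t(1)] by (simp add: o_def)
  have "A' = root_poly n l"
    by (rule coeff_tendsto_root_poly_unique[OF coeff_tendsto_subseq[OF A s(1)] s(2)])
  moreover have "B' = root_poly n w"
    by (rule coeff_tendsto_root_poly_unique[OF coeff_tendsto_subseq[OF B' t(1)] t(2)])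
  moreover have "(\<Sum>i<n. f (l i)) \<le> (\<Sum>i<n. f (w i))" if f: "convex_on UNIV f" for f
  proof (rule LIMSEQ_le)
    have "isCont f z" for z :: real
      using convex_on_continuous[OF open_UNIV f] by (simp add: continuous_on_eq_continuous_at)
    then have c: "(\<lambda>k. f (g k)) \<longlonglongrightarrow> f z" if "g \<longlonglongrightarrow> z" for g :: "nat \<Rightarrow> real" and z
      using that by (rule isCont_tendsto_compose)
    show "(\<lambda>k. \<Sum>i<n. f (x (\<sigma> (\<tau> k)) i)) \<longlonglongrightarrow> (\<Sum>i<n. f (l i))"
      by (intro tendsto_sum c s') simp
    show "(\<lambda>k. \<Sum>i<n. f (y (\<sigma> (\<tau> k)) i)) \<longlonglongrightarrow> (\<Sum>i<n. f (w i))"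
      by (intro tendsto_sum c t) simp
    show "\<exists>N. \<forall>k\<ge>N. (\<Sum>i<n. f (x (\<sigma> (\<tau> k)) i)) \<le> (\<Sum>i<n. f (y (\<sigma> (\<tau> k)) i))"
      using xy(3)[OF f] by blast
  qed
  ultimately show ?thesis by (simp add: poly_spectral_le_root_poly)
qed

section \<open>Differential operators given by power series\<close>

text \<open>Formal series instead of functions: products of series become compositions of operators,
  and analysis enters only through Taylor coefficients.\<close>

definition fps_op :: "real fps \<Rightarrow> real poly \<Rightarrow> real poly" where
  "fps_op F P = (\<Sum>k\<le>degree P. smult (fps_nth F k) ((pderiv ^^ k) P))"

lemma higher_pderiv_eq_0: "degree P < k \<Longrightarrow> (pderiv ^^ k) P = 0" for P :: "real poly"
  by (intro poly_eqI) (simp add: coeff_higher_pderiv coeff_eq_0)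

lemma fps_op_eq_sum:
  assumes "degree P \<le> N"
  shows "fps_op F P = (\<Sum>k\<le>N. smult (fps_nth F k) ((pderiv ^^ k) P))"
  unfolding fps_op_def
  by (rule sum.mono_neutral_left) (use assms in \<open>auto simp: higher_pderiv_eq_0\<close>)

lemma coeff_fps_op:
  assumes "degree P \<le> N"
  shows "coeff (fps_op F P) i = (\<Sum>k\<le>N. fps_nth F k * (pochhammer (of_nat (Suc i)) k * coeff P (i + k)))"
  unfolding fps_op_eq_sum[OF assms] by (simp add: coeff_sum coeff_higher_pderiv)

lemma degree_fps_op_le: "degree (fps_op F P) \<le> degree P"
  by (rule degree_le) (simp add: coeff_fps_op[OF order_refl] coeff_eq_0)

lemma smult_sum_right: "smult c (sum f A) = (\<Sum>x\<in>A. smult c (f x))"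
  by (induction A rule: infinite_finite_induct) (simp_all add: smult_add_right)

text \<open>Composition is the Cauchy product. Since multiplication of series commutes, so do all
  these operators, which is what \<open>fps_le_mult\<close> exploits.\<close>

lemma fps_op_mult: "fps_op (F * G) P = fps_op F (fps_op G P)"
proof -
  define N where "N = degree P"
  let ?g = "\<lambda>i j. smult (fps_nth F i * fps_nth G j) ((pderiv ^^ (i + j)) P)"
  have "fps_op (F * G) P = (\<Sum>k\<le>N. \<Sum>i\<le>k. ?g i (k - i))"
    unfolding fps_op_def N_def[symmetric] fps_mult_nth
    by (simp add: smult_sum[symmetric] atLeast0AtMost)
  also have "\<dots> = (\<Sum>(i, j)\<in>{(i, j). i + j \<le> N}. ?g i j)"
    by (rule sum.triangle_reindex_eq[symmetric])
  \<comment> \<open>The triangle may be filled up to a square, since the added terms differentiate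
    more than \<open>degree P\<close> times.\<close>
  also have "\<dots> = (\<Sum>(i, j)\<in>{..N} \<times> {..N}. ?g i j)"
    by (rule sum.mono_neutral_left) (auto simp: N_def intro!: higher_pderiv_eq_0)
  also have "\<dots> = (\<Sum>i\<le>N. \<Sum>j\<le>N. ?g i j)"
    by (simp add: sum.cartesian_product)
  also have "\<dots> = (\<Sum>i\<le>N. smult (fps_nth F i) ((pderiv ^^ i) (fps_op G P)))"
    unfolding fps_op_def[of G P] N_def[symmetric]
    by (simp add: higher_pderiv_sum higher_pderiv_smult smult_sum_right funpow_add)
  also have "\<dots> = fps_op F (fps_op G P)"
    by (rule fps_op_eq_sum[symmetric]) (simp add: N_def degree_fps_op_le)
  finally show ?thesis .
qed

lemma fps_op_1: "fps_op 1 P = P"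
proof -
  have "fps_op 1 P = (\<Sum>k\<le>degree P. if k = 0 then P else 0)"
    unfolding fps_op_def by (intro sum.cong) auto
  then show ?thesis by simp
qed

lemma fps_op_diff: "fps_op (F - G) P = fps_op F P - fps_op G P"
  by (simp add: fps_op_def smult_diff_left sum_subtractf)

lemma fps_op_const_mult: "fps_op (fps_const a * F) P = smult a (fps_op F P)"
  by (simp add: fps_op_def smult_sum_right)

lemma fps_op_X: "fps_op fps_X P = pderiv P"
proof -
  have "fps_op fps_X P = (\<Sum>k\<le>Suc (degree P). if k = 1 then pderiv P else 0)"
    unfolding fps_op_eq_sum[of P "Suc (degree P)", OF le_SucI[OF order_refl]]
    by (intro sum.cong) auto
  then show ?thesis by (simp add: sum.delta)
qed

lemma fps_op_X_power: "fps_op (fps_X ^ m) P = (pderiv ^^ m) P"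
  by (induction m) (simp_all add: fps_op_1 fps_op_mult fps_op_X)

text \<open>Taylor's formula with the remainder taken at order \<open>degree P + 1\<close>, where
  the derivative vanishes.\<close>

lemma poly_fps_op_exp: "poly (fps_op (fps_exp b) P) x = poly P (x + b)"
proof -
  define N where "N = Suc (degree P)"
  have "\<exists>t. \<bar>t\<bar> \<le> \<bar>b\<bar> \<and> poly P (x + b) =
      (\<Sum>m<N. (poly ((pderiv ^^ m) P) (x + 0) / fact m) * b ^ m) +
      (poly ((pderiv ^^ N) P) (x + t) / fact N) * b ^ N"
  proof (rule Maclaurin_all_le, simp, intro allI)
    fix m t
    show "DERIV (\<lambda>h. poly ((pderiv ^^ m) P) (x + h)) t :> poly ((pderiv ^^ Suc m) P) (x + t)"
      by (auto intro!: derivative_eq_intros DERIV_chain2[OF poly_DERIV])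
  qed
  then have "poly P (x + b) = (\<Sum>m<N. (poly ((pderiv ^^ m) P) x / fact m) * b ^ m)"
    using higher_pderiv_eq_0[of P N] by (simp add: N_def)
  also have "\<dots> = poly (fps_op (fps_exp b) P) x"
    unfolding fps_op_def N_def
    by (simp add: poly_sum lessThan_Suc_atMost[symmetric] mult.commute)
  finally show ?thesis by simp
qed

lemma fps_op_exp_root_poly:
  "fps_op (fps_exp b) (root_poly n r) = root_poly n (\<lambda>i. r i - b)"
proof -
  have "poly (fps_op (fps_exp b) (root_poly n r)) x = poly (root_poly n (\<lambda>i. r i - b)) x" for x
    by (simp add: poly_fps_op_exp poly_root_poly algebra_simps)
  then show ?thesis by (simp add: poly_eq_poly_eq_iff[symmetric] fun_eq_iff)
qed

lemma fps_op_monic: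
  assumes "degree P = n" "lead_coeff P = 1" "fps_nth F 0 = 1"
  shows "degree (fps_op F P) = n \<and> lead_coeff (fps_op F P) = 1"
proof -
  have "coeff (fps_op F P) n = (\<Sum>k\<le>n. if k = 0 then 1 else 0)"
    unfolding coeff_fps_op[OF eq_refl[OF assms(1)]]
    by (intro sum.cong) (use assms in \<open>auto simp: coeff_eq_0\<close>)
  then have *: "coeff (fps_op F P) n = 1" by simp
  then have "n \<le> degree (fps_op F P)" by (intro le_degree) simp
  with degree_fps_op_le[of F P] assms(1) have "degree (fps_op F P) = n" by simp
  with * show ?thesis by simp
qed

text \<open>The uniform degree bound makes each output coefficient a finite sum of fixed length.
  Continuity is joint: the operator varies for the Gaussian and the infinite product, the polynomial
  when multiple zeros are separated.\<close>

lemma coeff_tendsto_fps_op: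
  assumes "\<And>i. (\<lambda>k. fps_nth (F k) i) \<longlonglongrightarrow> fps_nth G i"
    and "coeff_tendsto Q P" "\<And>k. degree (Q k) \<le> n"
  shows "coeff_tendsto (\<lambda>k. fps_op (F k) (Q k)) (fps_op G P)"
  using assms(1,2) unfolding coeff_tendsto_def coeff_fps_op[OF assms(3)]
    coeff_fps_op[OF coeff_tendsto_degree_le[OF assms(2,3)]]
  by (auto intro!: tendsto_intros)

text \<open>Since \<open>poly_spectral_le\<close> contains membership in \<open>hyp_polys\<close>,
  the relation also asserts that both operators preserve real-rootedness. In particular
  \<open>fps_le F F\<close> is not automatic: it says that F preserves every
  \<open>hyp_polys n\<close>.\<close>

definition fps_le :: "real fps \<Rightarrow> real fps \<Rightarrow> bool" where
  "fps_le F G \<longleftrightarrow> (\<forall>n. \<forall>P\<in>hyp_polys n. poly_spectral_le n (fps_op F P) (fps_op G P))"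

text \<open>The chain is F F' P, then G F' P = F' G P, then G' G P. The two comparisons are applied
  to F' P and G P, which are real-rooted because \<open>fps_le\<close> includes
  preservation.\<close>

lemma fps_le_mult:
  assumes "fps_le F G" "fps_le F' G'"
  shows "fps_le (F * F') (G * G')"
  unfolding fps_le_def
proof (intro allI ballI)
  fix n P assume P: "P \<in> hyp_polys n"
  have 1: "poly_spectral_le n (fps_op F (fps_op F' P)) (fps_op G (fps_op F' P))"
    using assms P by (meson fps_le_def poly_spectral_le_def)
  have 2: "poly_spectral_le n (fps_op F' (fps_op G P)) (fps_op G' (fps_op G P))"
    using assms P by (meson fps_le_def poly_spectral_le_def)
  have "fps_op G (fps_op F' P) = fps_op F' (fps_op G P)" "fps_op G' (fps_op G P) = fps_op (G * G') P"
    by (simp_all add: fps_op_mult[symmetric] mult.commute)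
  with poly_spectral_le_trans[OF 1, of "fps_op G' (fps_op G P)"] 2
  show "poly_spectral_le n (fps_op (F * F') P) (fps_op (G * G') P)"
    by (simp add: fps_op_mult[of F F'])
qed

lemma fps_le_1: "fps_le 1 1"
  by (simp add: fps_le_def fps_op_1 poly_spectral_le_refl)

lemma fps_le_prod: "(\<And>i. i \<in> A \<Longrightarrow> fps_le (F i) (G i)) \<Longrightarrow> fps_le (prod F A) (prod G A)"
  by (induction A rule: infinite_finite_induct) (auto intro: fps_le_1 fps_le_mult)

lemma fps_le_power: "fps_le F G \<Longrightarrow> fps_le (F ^ k) (G ^ k)"
  by (induction k) (auto intro: fps_le_1 fps_le_mult)

lemma fps_le_exp: "fps_le (fps_exp b) (fps_exp b)"
  unfolding fps_le_def
proof (intro allI ballI)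
  fix n P assume "P \<in> hyp_polys n"
  then obtain r where "P = root_poly n r" using hyp_polys_imp_root_poly by blast
  then show "poly_spectral_le n (fps_op (fps_exp b) P) (fps_op (fps_exp b) P)"
    by (simp add: fps_op_exp_root_poly poly_spectral_le_refl root_poly_in_hyp_polys)
qed

lemma fps_le_limit:
  assumes "\<And>k. fps_le (F k) (G k)"
    and "\<And>i. (\<lambda>k. fps_nth (F k) i) \<longlonglongrightarrow> fps_nth F' i"
    and "\<And>i. (\<lambda>k. fps_nth (G k) i) \<longlonglongrightarrow> fps_nth G' i"
  shows "fps_le F' G'"
  unfolding fps_le_def
proof (intro allI ballI)
  fix n P assume P: "P \<in> hyp_polys n"
  show "poly_spectral_le n (fps_op F' P) (fps_op G' P)"
  proof (rule poly_spectral_le_limit)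
    show "poly_spectral_le n (fps_op (F k) P) (fps_op (G k) P)" for k
      using assms(1) P by (simp add: fps_le_def)
    show "coeff_tendsto (\<lambda>k. fps_op (F k) P) (fps_op F' P)"
      by (rule coeff_tendsto_fps_op[OF assms(2) coeff_tendsto_const order_refl])
    show "coeff_tendsto (\<lambda>k. fps_op (G k) P) (fps_op G' P)"
      by (rule coeff_tendsto_fps_op[OF assms(3) coeff_tendsto_const order_refl])
  qed
qed

section \<open>Preservation of real-rootedness\<close>

text \<open>The logarithmic derivative, over a general field because it serves twice: over the
  complex numbers for real-rootedness and over the reals for the secular equation.\<close>

lemma poly_pderiv_prod_linear:
  fixes r :: "nat \<Rightarrow> 'a :: field"
  assumes "\<And>i. i < n \<Longrightarrow> x \<noteq> r i"
  shows "poly (pderiv (\<Prod>i<n. [:- r i, 1:])) x = (\<Prod>i<n. (x - r i)) * (\<Sum>i<n. 1 / (x - r i))"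
  using assms
proof (induction n)
  case (Suc n)
  then have "x - r n \<noteq> 0" by simp
  with Suc show ?case
    by (simp add: pderiv_mult pderiv_pCons poly_prod field_simps del: mult_pCons_left mult_pCons_right)
qed simp

lemma poly_pderiv_root_poly_at_root:
  assumes "j < n"
  shows "poly (pderiv (root_poly n r)) (r j) = (\<Prod>i\<in>{..<n} - {j}. (r j - r i))"
proof -
  have "poly (pderiv (root_poly n r)) (r j) = (\<Sum>k<n. \<Prod>i\<in>{..<n} - {k}. (r j - r i))"
    by (simp add: root_poly_def pderiv_prod poly_sum poly_prod pderiv_pCons)
  also have "\<dots> = (\<Sum>k<n. if k = j then \<Prod>i\<in>{..<n} - {j}. (r j - r i) else 0)"
    by (intro sum.cong) (use assms in auto)
  finally show ?thesis using assms by simp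
qed

text \<open>Each 1/(z - r) with r real has imaginary part of sign opposite to that of Im z, so
  nothing cancels.\<close>

lemma Im_sum_inverse_nonzero:
  fixes r :: "nat \<Rightarrow> real"
  assumes "Im z \<noteq> 0" "n > 0"
  shows "Im (\<Sum>i<n. 1 / (z - of_real (r i))) \<noteq> 0"
proof -
  have pos: "(Re z - r i)\<^sup>2 + (Im z)\<^sup>2 > 0" for i
    using assms(1) by (simp add: add_nonneg_pos)
  have "Im (\<Sum>i<n. 1 / (z - of_real (r i))) = - Im z * (\<Sum>i<n. 1 / ((Re z - r i)\<^sup>2 + (Im z)\<^sup>2))"
    by (simp add: Im_divide sum_distrib_left)
  moreover have "(\<Sum>i<n. 1 / ((Re z - r i)\<^sup>2 + (Im z)\<^sup>2)) > 0"
    using assms(2) pos by (intro sum_pos) auto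
  ultimately show ?thesis using assms(1) by simp
qed

lemma complex_log_deriv_root_poly:
  assumes "Im z \<noteq> 0"
  shows "poly (map_poly complex_of_real (root_poly n r)) z \<noteq> 0"
    and "poly (pderiv (map_poly complex_of_real (root_poly n r))) z =
      poly (map_poly complex_of_real (root_poly n r)) z * (\<Sum>i<n. 1 / (z - of_real (r i)))"
proof -
  have ne: "z \<noteq> of_real (r i)" for i using assms by auto
  then show "poly (map_poly complex_of_real (root_poly n r)) z \<noteq> 0"
    by (simp add: map_poly_of_real_root_poly poly_prod)
  show "poly (pderiv (map_poly complex_of_real (root_poly n r))) z =
      poly (map_poly complex_of_real (root_poly n r)) z * (\<Sum>i<n. 1 / (z - of_real (r i)))"
    using poly_pderiv_prod_linear[of n z "\<lambda>i. of_real (r i)"] ne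
    by (simp add: map_poly_of_real_root_poly poly_prod)
qed

text \<open>At a nonreal zero, dividing by P gives a S = 1 with S the logarithmic derivative, but S
  has nonzero imaginary part.\<close>

lemma hyp_polys_diff_pderiv:
  assumes "P \<in> hyp_polys n"
  shows "P - smult a (pderiv P) \<in> hyp_polys n"
proof -
  obtain r where r: "P = root_poly n r" using assms hyp_polys_imp_root_poly by blast
  have "P - smult a (pderiv P) = fps_op (1 - fps_const a * fps_X) P"
    by (simp add: fps_op_diff fps_op_1 fps_op_const_mult fps_op_X)
  then have deg: "degree (P - smult a (pderiv P)) = n" "lead_coeff (P - smult a (pderiv P)) = 1"
    using fps_op_monic[of P n "1 - fps_const a * fps_X"] assms by (auto simp: hyp_polys_def)
  have "z \<in> \<real>" if z: "poly (map_poly complex_of_real (P - smult a (pderiv P))) z = 0" for z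
  proof (rule ccontr)
    assume "z \<notin> \<real>"
    then have im: "Im z \<noteq> 0" by (simp add: complex_is_Real_iff)
    let ?S = "\<Sum>i<n. 1 / (z - of_real (r i))"
    note L = complex_log_deriv_root_poly[OF im, of n r]
    have "poly (map_poly complex_of_real (root_poly n r)) z -
        of_real a * (poly (map_poly complex_of_real (root_poly n r)) z * ?S) = 0"
      using z unfolding map_poly_of_real_diff map_poly_of_real_smult map_poly_of_real_pderiv r
        poly_diff poly_smult L(2) .
    then have "poly (map_poly complex_of_real (root_poly n r)) z * (1 - of_real a * ?S) = 0"
      by (simp only: right_diff_distrib mult_1_right mult.left_commute)
    with L(1) have S: "of_real a * ?S = 1" by (simp del: Im_sum Re_sum)
    then have "a \<noteq> 0" "n > 0" by (auto intro!: Nat.gr0I)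
    moreover have "a * Im ?S = 0" using arg_cong[OF S, of Im] by (simp del: Im_sum)
    ultimately show False using Im_sum_inverse_nonzero[OF im, of n r] by simp
  qed
  with deg show ?thesis by (simp add: hyp_polys_def)
qed

text \<open>The same argument as for P - a P', now with S = 0 at a nonreal zero.\<close>

lemma hyp_polys_pderiv:
  assumes "P \<in> hyp_polys (Suc n)"
  shows "smult (1 / of_nat (Suc n)) (pderiv P) \<in> hyp_polys n"
proof -
  obtain r where r: "P = root_poly (Suc n) r" using assms hyp_polys_imp_root_poly by blast
  have d: "degree P = Suc n" "coeff P (Suc n) = 1" using assms by (auto simp: hyp_polys_def)
  have "z \<in> \<real>" if z: "poly (map_poly complex_of_real (smult (1 / of_nat (Suc n)) (pderiv P))) z = 0" for z
  proof (rule ccontr)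
    assume "z \<notin> \<real>"
    then have im: "Im z \<noteq> 0" by (simp add: complex_is_Real_iff)
    let ?S = "\<Sum>i<Suc n. 1 / (z - of_real (r i))"
    note L = complex_log_deriv_root_poly[OF im, of "Suc n" r]
    have "poly (pderiv (map_poly complex_of_real (root_poly (Suc n) r))) z = 0"
      using z unfolding map_poly_of_real_smult map_poly_of_real_pderiv r
      by (simp del: of_nat_Suc)
    with L have "?S = 0" by simp
    then show False using Im_sum_inverse_nonzero[OF im, of "Suc n" r] by (metis zero_complex.sel(2) zero_less_Suc)
  qed
  with d show ?thesis by (simp add: hyp_polys_def degree_pderiv coeff_pderiv del: of_nat_Suc)
qed

text \<open>The scalar is the reciprocal of n (n-1) ... (n-m+1), the leading coefficient that m
  differentiations produce.\<close>

lemma hyp_polys_higher_pderiv: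
  assumes "P \<in> hyp_polys n" "m \<le> n"
  shows "smult (fact (n - m) / fact n) ((pderiv ^^ m) P) \<in> hyp_polys (n - m)"
  using assms(2)
proof (induction m)
  case 0
  then show ?case using assms(1) by simp
next
  case (Suc m)
  then have e: "n - m = Suc (n - Suc m)" by simp
  from Suc have "smult (fact (n - m) / fact n) ((pderiv ^^ m) P) \<in> hyp_polys (Suc (n - Suc m))"
    by (simp add: e)
  from hyp_polys_pderiv[OF this] show ?case
    by (simp add: pderiv_smult e del: of_nat_Suc)
qed

section \<open>A rank-one perturbation of a diagonal matrix\<close>

text \<open>The matrix P of inner products of columns is symmetric and idempotent, so P_jj is the
  squared norm of its row j. This gives P_jj \<le> 1, and trace n then forces P_jj = 1 and vanishing
  off-diagonal entries.\<close>

lemma orthonormal_rows_imp_columns: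
  fixes V :: "nat \<Rightarrow> nat \<Rightarrow> real"
  assumes "\<And>i k. i < n \<Longrightarrow> k < n \<Longrightarrow> (\<Sum>j<n. V i j * V k j) = (if i = k then 1 else 0)"
    and "j < n" "l < n"
  shows "(\<Sum>i<n. V i j * V i l) = (if j = l then 1 else 0)"
proof -
  define P where "P j l = (\<Sum>i<n. V i j * V i l)" for j l
  have idem: "(\<Sum>m<n. (P j m)\<^sup>2) = P j j" for j
  proof -
    have "(\<Sum>m<n. (P j m)\<^sup>2) = (\<Sum>m<n. \<Sum>i<n. \<Sum>k<n. V i j * V k j * (V i m * V k m))"
      by (simp add: P_def power2_eq_square sum_product mult_ac)
    also have "\<dots> = (\<Sum>i<n. \<Sum>m<n. \<Sum>k<n. V i j * V k j * (V i m * V k m))"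
      by (rule sum.swap)
    also have "\<dots> = (\<Sum>i<n. \<Sum>k<n. \<Sum>m<n. V i j * V k j * (V i m * V k m))"
      by (intro sum.cong refl sum.swap)
    also have "\<dots> = (\<Sum>i<n. \<Sum>k<n. V i j * V k j * (if i = k then 1 else 0))"
      by (intro sum.cong refl) (simp add: sum_distrib_left[symmetric] assms(1))
    also have "\<dots> = (\<Sum>i<n. \<Sum>k<n. if k = i then V i j * V i j else 0)"
      by (intro sum.cong refl) simp
    also have "\<dots> = P j j" by (simp add: P_def)
    finally show ?thesis .
  qed
  have le1: "P j j \<le> 1" if "j < n" for j
  proof -
    have "(P j j)\<^sup>2 \<le> (\<Sum>m<n. (P j m)\<^sup>2)"
      using that by (intro member_le_sum) auto
    then have "P j j * (1 - P j j) \<ge> 0" unfolding idem by (simp add: power2_eq_square algebra_simps)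
    then show ?thesis by (auto simp: zero_le_mult_iff)
  qed
  have "(\<Sum>j<n. P j j) = (\<Sum>i<n. \<Sum>j<n. V i j * V i j)"
    unfolding P_def by (rule sum.swap)
  also have "\<dots> = (\<Sum>j<n. 1)" by (simp add: assms(1))
  finally have "(\<Sum>j<n. 1 - P j j) = 0" by (simp add: sum_subtractf)
  then have diag: "P j j = 1" if "j < n" for j
    using that le1 by (subst (asm) sum_nonneg_eq_0_iff) auto
  have "(\<Sum>m<n. (P j m)\<^sup>2) = (P j j)\<^sup>2 + (\<Sum>m\<in>{..<n} - {j}. (P j m)\<^sup>2)"
    using assms(2) by (intro sum.remove) auto
  then have "(\<Sum>m\<in>{..<n} - {j}. (P j m)\<^sup>2) = 0"
    using idem[of j] diag[OF assms(2)] by simp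
  then have "P j l = 0" if "j \<noteq> l"
    using that assms(3) by (subst (asm) sum_nonneg_eq_0_iff) auto
  then show ?thesis using diag[OF assms(2)] by (auto simp: P_def)
qed

text \<open>The \<mu> are the eigenvalues of diag(q) + a J, encoded through the characteristic
  polynomial. Distinct q and nonzero a exclude eigenvalues at the q_j, so every eigenvector has the
  explicit form \<open>V\<close> below.\<close>

locale secular =
  fixes n :: nat and q \<mu> :: "nat \<Rightarrow> real" and a :: real
  assumes inj_q: "inj_on q {..<n}" and a_nz: "a \<noteq> 0"
    and char: "root_poly n q - smult a (pderiv (root_poly n q)) = root_poly n \<mu>"
begin

text \<open>At q_j the characteristic polynomial has value -a Q'(q_j), which is nonzero at a simple
  zero. This makes all later denominators nonzero.\<close>

lemma root_neq:
  assumes "i < n" "j < n"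
  shows "\<mu> i \<noteq> q j"
proof
  assume eq: "\<mu> i = q j"
  have "poly (root_poly n q) (q j) - a * poly (pderiv (root_poly n q)) (q j) = poly (root_poly n \<mu>) (\<mu> i)"
    unfolding char[symmetric] eq by simp
  moreover have "poly (root_poly n q) (q j) = 0" "poly (root_poly n \<mu>) (\<mu> i) = 0"
    using assms by (auto simp: poly_root_poly)
  ultimately have "poly (pderiv (root_poly n q)) (q j) = 0"
    using a_nz by simp
  then show False
    using assms inj_q by (auto simp: poly_pderiv_root_poly_at_root inj_on_def)
qed

lemma poly_char:
  assumes "\<And>j. j < n \<Longrightarrow> x \<noteq> q j"
  shows "poly (root_poly n \<mu>) x = poly (root_poly n q) x * (1 - a * (\<Sum>j<n. 1 / (x - q j)))"
  unfolding char[symmetric] using poly_pderiv_prod_linear[of n x q] assms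
  by (simp add: root_poly_def poly_prod algebra_simps)

lemma secular_equation:
  assumes "i < n"
  shows "(\<Sum>j<n. 1 / (\<mu> i - q j)) = 1 / a"
proof -
  have "poly (root_poly n q) (\<mu> i) \<noteq> 0"
    using root_neq[OF assms] by (auto simp: poly_root_poly)
  moreover have "poly (root_poly n \<mu>) (\<mu> i) = 0"
    using assms by (auto simp: poly_root_poly)
  ultimately show ?thesis
    using poly_char[of "\<mu> i"] root_neq[OF assms] a_nz by (auto simp: field_simps)
qed

lemma norm2_pos:
  assumes "i < n"
  shows "(\<Sum>j<n. 1 / (\<mu> i - q j)\<^sup>2) > 0"
  using assms root_neq[OF assms] by (intro sum_pos) auto

text \<open>Differentiating Q (1 - a sum_j 1/(x - q_j)) at \<mu> i leaves only Q a sum_j 1/(\<mu> i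
  - q_j)^2, by the secular equation. This is nonzero, whereas a repeated eigenvalue would make the
  derivative vanish.\<close>

lemma inj_roots: "inj_on \<mu> {..<n}"
proof (rule inj_onI, rule ccontr)
  fix i k assume ik: "i \<in> {..<n}" "k \<in> {..<n}" "\<mu> i = \<mu> k" "i \<noteq> k"
  then have i: "i < n" by simp
  have "poly (pderiv (root_poly n \<mu>)) (\<mu> i) = 0"
    unfolding poly_pderiv_root_poly_at_root[OF i] using ik by (intro prod_zero) auto
  then have d1: "(poly (root_poly n \<mu>) has_real_derivative 0) (at (\<mu> i))"
    using poly_DERIV[of "root_poly n \<mu>" "\<mu> i"] by simp
  let ?Q = "root_poly n q"
  have "((\<lambda>x. poly ?Q x * (1 - a * (\<Sum>j<n. 1 / (x - q j)))) has_real_derivative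
      (poly (pderiv ?Q) (\<mu> i) * (1 - a * (\<Sum>j<n. 1 / (\<mu> i - q j))) +
       poly ?Q (\<mu> i) * (a * (\<Sum>j<n. 1 / (\<mu> i - q j)\<^sup>2)))) (at (\<mu> i))"
    using root_neq[OF i]
    by (auto intro!: derivative_eq_intros poly_DERIV simp: power2_eq_square sum_negf)
  then have "(poly (root_poly n \<mu>) has_real_derivative
       (poly ?Q (\<mu> i) * (a * (\<Sum>j<n. 1 / (\<mu> i - q j)\<^sup>2)))) (at (\<mu> i))"
  proof -
    assume d2: "((\<lambda>x. poly ?Q x * (1 - a * (\<Sum>j<n. 1 / (x - q j)))) has_real_derivative
      (poly (pderiv ?Q) (\<mu> i) * (1 - a * (\<Sum>j<n. 1 / (\<mu> i - q j))) +
       poly ?Q (\<mu> i) * (a * (\<Sum>j<n. 1 / (\<mu> i - q j)\<^sup>2)))) (at (\<mu> i))"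
    \<comment> \<open>The factored form of the characteristic polynomial holds only off the points
      q_j; that set is open, so the derivative transfers.\<close>
    have "open (- q ` {..<n})" by (intro open_Compl finite_imp_closed) simp
    moreover have "\<mu> i \<in> - q ` {..<n}" using root_neq[OF i] by auto
    ultimately have "(poly (root_poly n \<mu>) has_real_derivative
      (poly (pderiv ?Q) (\<mu> i) * (1 - a * (\<Sum>j<n. 1 / (\<mu> i - q j))) +
       poly ?Q (\<mu> i) * (a * (\<Sum>j<n. 1 / (\<mu> i - q j)\<^sup>2)))) (at (\<mu> i))"
      by (rule has_field_derivative_transform_within_open[OF d2]) (rule poly_char[symmetric], auto)
    then show ?thesis unfolding secular_equation[OF i] using a_nz by simp
  qed
  from DERIV_unique[OF this d1] have "poly ?Q (\<mu> i) = 0" using a_nz norm2_pos[OF i] by simp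
  then show False using root_neq[OF i] by (auto simp: poly_root_poly)
qed

text \<open>Row i is the unit eigenvector of diag(q) + a J for \<mu> i: the eigenvector equation
  (\<mu> i - q_j) v_j = a sum_k v_k makes v_j proportional to 1/(\<mu> i - q_j).\<close>

definition V :: "nat \<Rightarrow> nat \<Rightarrow> real" where
  "V i j = 1 / (\<mu> i - q j) / sqrt (\<Sum>j<n. 1 / (\<mu> i - q j)\<^sup>2)"

lemma rows:
  assumes "i < n" "k < n"
  shows "(\<Sum>j<n. V i j * V k j) = (if i = k then 1 else 0)"
proof (cases "i = k")
  case True
  let ?N = "\<Sum>j<n. 1 / (\<mu> i - q j)\<^sup>2"
  have "(\<Sum>j<n. V i j * V i j) = (\<Sum>j<n. 1 / (\<mu> i - q j)\<^sup>2 / ?N)"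
    using norm2_pos[OF assms(1)] by (intro sum.cong) (auto simp: V_def power2_eq_square)
  also have "\<dots> = 1"
    unfolding sum_divide_distrib[symmetric] using norm2_pos[OF assms(1)] by simp
  finally show ?thesis using True by simp
next
  case False
  then have ne: "\<mu> i \<noteq> \<mu> k" using inj_roots assms by (auto simp: inj_on_def)
  \<comment> \<open>Partial fractions reduce orthogonality to the difference of two secular
    equations, both with value 1/a.\<close>
  have "(\<Sum>j<n. 1 / (\<mu> i - q j) * (1 / (\<mu> k - q j))) =
      (\<Sum>j<n. (1 / (\<mu> k - q j) - 1 / (\<mu> i - q j)) / (\<mu> i - \<mu> k))"
    using ne root_neq[OF assms(1)] root_neq[OF assms(2)]
    by (intro sum.cong) (auto simp: divide_simps)
  also have "\<dots> = 0"
    by (simp add: sum_divide_distrib[symmetric] sum_subtractf secular_equation assms)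
  finally have "(\<Sum>j<n. 1 / (\<mu> i - q j) * (1 / (\<mu> k - q j))) = 0" .
  moreover have "(\<Sum>j<n. V i j * V k j) = (\<Sum>j<n. 1 / (\<mu> i - q j) * (1 / (\<mu> k - q j))) /
      (sqrt (\<Sum>j<n. 1 / (\<mu> i - q j)\<^sup>2) * sqrt (\<Sum>j<n. 1 / (\<mu> k - q j)\<^sup>2))"
    by (simp add: V_def sum_divide_distrib mult_ac)
  ultimately show ?thesis using False by simp
qed

lemmas columns = orthonormal_rows_imp_columns[OF rows]

text \<open>The eigenvector equation for row i, multiplied by \<open>V i l\<close> and summed over
  i, collapses by orthonormality of the columns. The result is the entry (j, l) of diag(q) + a
  J.\<close>

lemma spectral_decomposition:
  assumes "j < n" "l < n"
  shows "(\<Sum>i<n. \<mu> i * (V i j * V i l)) = (if j = l then q j else 0) + a"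
proof -
  let ?N = "\<lambda>i. sqrt (\<Sum>j<n. 1 / (\<mu> i - q j)\<^sup>2)"
  have "\<mu> i * (V i j * V i l) = q j * (V i j * V i l) + a * (\<Sum>k<n. V i k * V i l)" if i: "i < n" for i
  proof -
    have "a * (\<Sum>k<n. V i k) = 1 / ?N i"
      unfolding V_def sum_divide_distrib[symmetric] secular_equation[OF i] using a_nz by simp
    also have "\<dots> = (\<mu> i - q j) * V i j"
      using root_neq[OF i assms(1)] by (simp add: V_def)
    finally have "a * (\<Sum>k<n. V i k) * V i l = (\<mu> i - q j) * V i j * V i l" by simp
    then show ?thesis by (simp add: sum_distrib_right[symmetric] algebra_simps)
  qed
  then have "(\<Sum>i<n. \<mu> i * (V i j * V i l)) =
      (\<Sum>i<n. q j * (V i j * V i l) + a * (\<Sum>k<n. V i k * V i l))"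
    by (intro sum.cong) auto
  also have "\<dots> = q j * (\<Sum>i<n. V i j * V i l) + a * (\<Sum>i<n. \<Sum>k<n. V i k * V i l)"
    by (simp add: sum.distrib sum_distrib_left)
  also have "(\<Sum>i<n. \<Sum>k<n. V i k * V i l) = (\<Sum>k<n. \<Sum>i<n. V i k * V i l)"
    by (rule sum.swap)
  finally show ?thesis using assms by (simp add: columns)
qed

end

text \<open>With v_i and w_k the rows of V and W, \<open>AB\<close> says that A = sum x_i v_i v_i^T
  arises from B = sum y_k w_k w_k^T by multiplying the off-diagonal entries by \<theta>. Then x_i =
  v_i^T A v_i is an average of the y_k with doubly stochastic weights, and Jensen's inequality
  applies.\<close>

lemma majorization_pinching:
  fixes V W :: "nat \<Rightarrow> nat \<Rightarrow> real"
  assumes V: "\<And>i k. i < n \<Longrightarrow> k < n \<Longrightarrow> (\<Sum>j<n. V i j * V k j) = (if i = k then 1 else 0)"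
    and W: "\<And>i k. i < n \<Longrightarrow> k < n \<Longrightarrow> (\<Sum>j<n. W i j * W k j) = (if i = k then 1 else 0)"
    and \<theta>: "0 \<le> \<theta>" "\<theta> \<le> 1"
    and AB: "\<And>j l. j < n \<Longrightarrow> l < n \<Longrightarrow> (\<Sum>i<n. x i * (V i j * V i l)) =
        (if j = l then 1 else \<theta>) * (\<Sum>k<n. y k * (W k j * W k l))"
    and f: "convex_on UNIV f"
  shows "(\<Sum>i<n. f (x i)) \<le> (\<Sum>i<n. f (y i))"
proof -
  \<comment> \<open>\<open>C V W i k\<close> is the coefficient of y_k when v_i^T A v_i is
    expanded.\<close>
  define C where "C V W i k = (\<Sum>j<n. \<Sum>l<n. (if j = l then 1 else \<theta>) * (V i j * V i l * (W k j * W k l)))"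
    for V W :: "nat \<Rightarrow> nat \<Rightarrow> real" and i k
  \<comment> \<open>The weight is \<theta> everywhere plus 1 - \<theta> on the diagonal. This writes
    C through squares, showing nonnegativity and the symmetry under exchange of the two
    bases.\<close>
  have C_alt: "C V W i k = (1 - \<theta>) * (\<Sum>j<n. (V i j * W k j)\<^sup>2) + \<theta> * (\<Sum>j<n. V i j * W k j)\<^sup>2" for V W i k
  proof -
    have "C V W i k = (\<Sum>j<n. \<Sum>l<n. (if j = l then (1 - \<theta>) * (V i j * W k j)\<^sup>2 else 0) +
        \<theta> * ((V i j * W k j) * (V i l * W k l)))"
      unfolding C_def by (intro sum.cong refl) (auto simp: power2_eq_square algebra_simps)
    also have "\<dots> = (1 - \<theta>) * (\<Sum>j<n. (V i j * W k j)\<^sup>2) + \<theta> * (\<Sum>j<n. V i j * W k j)\<^sup>2"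
      unfolding power2_eq_square[of "sum _ _"] sum_product by (simp add: sum.distrib sum_distrib_left)
    finally show ?thesis .
  qed
  have C_nonneg: "C V W i k \<ge> 0" for i k
    unfolding C_alt using \<theta> by (intro add_nonneg_nonneg mult_nonneg_nonneg sum_nonneg) auto
  have C_apply: "(\<Sum>k<n. C V W i k * w k) =
      (\<Sum>j<n. \<Sum>l<n. V i j * V i l * ((if j = l then 1 else \<theta>) * (\<Sum>k<n. w k * (W k j * W k l))))"
    for V W i and w :: "nat \<Rightarrow> real"
  proof -
    have "(\<Sum>k<n. C V W i k * w k) =
      (\<Sum>k<n. \<Sum>j<n. \<Sum>l<n. V i j * V i l * ((if j = l then 1 else \<theta>) * (w k * (W k j * W k l))))"
      unfolding C_def sum_distrib_right by (intro sum.cong refl) (simp add: mult_ac)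
    also have "\<dots> = (\<Sum>j<n. \<Sum>k<n. \<Sum>l<n. V i j * V i l * ((if j = l then 1 else \<theta>) * (w k * (W k j * W k l))))"
      by (rule sum.swap)
    also have "\<dots> = (\<Sum>j<n. \<Sum>l<n. \<Sum>k<n. V i j * V i l * ((if j = l then 1 else \<theta>) * (w k * (W k j * W k l))))"
      by (intro sum.cong refl sum.swap)
    finally show ?thesis by (simp add: sum_distrib_left)
  qed
  \<comment> \<open>Taking all y_k = 1 makes B the identity, which the scaling fixes. Orthonormality
    is assumed afresh so that the fact also applies with the bases exchanged and yields the column
    sums.\<close>
  have C_row: "(\<Sum>k<n. C V W i k) = 1"
    if "i < n" and V: "\<And>i k. i < n \<Longrightarrow> k < n \<Longrightarrow> (\<Sum>j<n. V i j * V k j) = (if i = k then 1 else 0)"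
      and W: "\<And>i k. i < n \<Longrightarrow> k < n \<Longrightarrow> (\<Sum>j<n. W i j * W k j) = (if i = k then 1 else 0)" for V W i
  proof -
    have "(\<Sum>k<n. C V W i k) =
        (\<Sum>j<n. \<Sum>l<n. V i j * V i l * ((if j = l then 1 else \<theta>) * (\<Sum>k<n. W k j * W k l)))"
      using C_apply[of V W i "\<lambda>_. 1"] by simp
    also have "\<dots> = (\<Sum>j<n. \<Sum>l<n. if j = l then V i j * V i j else 0)"
      by (intro sum.cong refl) (simp add: orthonormal_rows_imp_columns[OF W])
    also have "\<dots> = 1" using V[OF that(1) that(1)] by simp
    finally show ?thesis .
  qed
  have "C V W i k = C W V k i" for i k
    by (simp add: C_alt mult.commute)
  then have C_col: "(\<Sum>i<n. C V W i k) = 1" if "k < n" for k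
    using C_row[OF that W V] by simp
  have x: "x i = (\<Sum>k<n. C V W i k * y k)" if i: "i < n" for i
  proof -
    have "(\<Sum>k<n. C V W i k * y k) = (\<Sum>j<n. \<Sum>l<n. V i j * V i l * (\<Sum>p<n. x p * (V p j * V p l)))"
      unfolding C_apply by (intro sum.cong refl) (simp add: AB)
    also have "\<dots> = (\<Sum>j<n. \<Sum>l<n. \<Sum>p<n. x p * ((V i j * V p j) * (V i l * V p l)))"
      by (simp add: sum_distrib_left mult_ac)
    also have "\<dots> = (\<Sum>j<n. \<Sum>p<n. \<Sum>l<n. x p * ((V i j * V p j) * (V i l * V p l)))"
      by (intro sum.cong refl sum.swap)
    also have "\<dots> = (\<Sum>p<n. \<Sum>j<n. \<Sum>l<n. x p * ((V i j * V p j) * (V i l * V p l)))"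
      by (rule sum.swap)
    also have "\<dots> = (\<Sum>p<n. x p * ((\<Sum>j<n. V i j * V p j) * (\<Sum>l<n. V i l * V p l)))"
      unfolding sum_product by (simp add: sum_distrib_left)
    also have "\<dots> = (\<Sum>p<n. if p = i then x p else 0)"
      using V[OF i] by (intro sum.cong) auto
    finally show ?thesis using i by simp
  qed
  have "(\<Sum>i<n. f (x i)) \<le> (\<Sum>i<n. \<Sum>k<n. C V W i k * f (y k))"
  proof (intro sum_mono)
    fix i assume "i \<in> {..<n}"
    then have i: "i < n" by simp
    have "f (\<Sum>k<n. C V W i k *\<^sub>R y k) \<le> (\<Sum>k<n. C V W i k * f (y k))"
      using i C_row[OF i V W] C_nonneg by (intro convex_on_sum[OF _ _ f]) auto
    then show "f (x i) \<le> (\<Sum>k<n. C V W i k * f (y k))" by (simp add: x[OF i])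
  qed
  also have "\<dots> = (\<Sum>k<n. \<Sum>i<n. C V W i k * f (y k))" by (rule sum.swap)
  also have "\<dots> = (\<Sum>k<n. f (y k))"
    by (intro sum.cong refl) (simp add: sum_distrib_right[symmetric] C_col)
  finally show ?thesis .
qed

section \<open>Monotonicity of a single factor\<close>

text \<open>The exponential cancels the linear coefficient, so the operator keeps the sum of the
  zeros. The order demands this, since both f(x) = x and f(x) = -x are convex.\<close>

definition lp_factor :: "real \<Rightarrow> real fps" where
  "lp_factor a = (1 - fps_const a * fps_X) * fps_exp a"

lemma fps_nth_lp_factor:
  "fps_nth (lp_factor a) i = a ^ i / fact i - a * (if i = 0 then 0 else a ^ (i - 1) / fact (i - 1))"
proof -
  have "lp_factor a = fps_exp a - fps_const a * (fps_X * fps_exp a)"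
    by (simp add: lp_factor_def algebra_simps)
  then show ?thesis by simp
qed

lemma tendsto_fps_nth_lp_factor:
  "g \<longlonglongrightarrow> a \<Longrightarrow> (\<lambda>k. fps_nth (lp_factor (g k)) i) \<longlonglongrightarrow> fps_nth (lp_factor a) i"
  unfolding fps_nth_lp_factor by (cases "i = 0") (auto intro!: tendsto_intros)

lemma fps_op_lp_factor_root_poly:
  assumes "inj_on q {..<n}" "a \<noteq> 0"
  obtains \<mu> where "secular n q \<mu> a"
    and "fps_op (lp_factor a) (root_poly n q) = root_poly n (\<lambda>i. \<mu> i - a)"
proof -
  obtain \<mu> where \<mu>: "root_poly n q - smult a (pderiv (root_poly n q)) = root_poly n \<mu>"
    using hyp_polys_diff_pderiv[OF root_poly_in_hyp_polys] hyp_polys_imp_root_poly by blast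
  have "fps_op (lp_factor a) (root_poly n q) = fps_op (fps_exp a) (fps_op (1 - fps_const a * fps_X) (root_poly n q))"
    unfolding lp_factor_def by (subst mult.commute) (rule fps_op_mult)
  also have "\<dots> = root_poly n (\<lambda>i. \<mu> i - a)"
    by (simp add: fps_op_diff fps_op_1 fps_op_const_mult fps_op_X \<mu> fps_op_exp_root_poly)
  finally show ?thesis using that[of \<mu>] assms \<mu> by (simp add: secular_def)
qed

lemma lp_factor_spectral_le_distinct:
  assumes q: "inj_on q {..<n}" and "b \<noteq> 0" "0 < \<theta>" "\<theta> \<le> 1"
  shows "poly_spectral_le n (fps_op (lp_factor (\<theta> * b)) (root_poly n q)) (fps_op (lp_factor b) (root_poly n q))"
proof -
  obtain \<mu> where m: "secular n q \<mu> (\<theta> * b)"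
    "fps_op (lp_factor (\<theta> * b)) (root_poly n q) = root_poly n (\<lambda>i. \<mu> i - \<theta> * b)"
    using fps_op_lp_factor_root_poly[OF q, of "\<theta> * b"] assms by auto
  obtain \<nu> where n: "secular n q \<nu> b"
    "fps_op (lp_factor b) (root_poly n q) = root_poly n (\<lambda>i. \<nu> i - b)"
    using fps_op_lp_factor_root_poly[OF q, of b] assms by auto
  interpret S: secular n q \<mu> "\<theta> * b" by (rule m)
  interpret T: secular n q \<nu> b by (rule n)
  \<comment> \<open>Lowering the eigenvalues by a subtracts a I, which cancels the diagonal of a J.
    Both matrices then have diagonal q, and off the diagonal \<theta> b stands against b.\<close>
  have shifted: "(\<Sum>i<n. (x i - a) * (V i j * V i l)) = (\<Sum>i<n. x i * (V i j * V i l)) - a * (\<Sum>i<n. V i j * V i l)"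
    for x a j l and V :: "nat \<Rightarrow> nat \<Rightarrow> real"
    by (simp add: left_diff_distrib sum_subtractf sum_distrib_left)
  show ?thesis
    unfolding m(2) n(2) poly_spectral_le_root_poly
  proof (intro allI impI)
    fix f :: "real \<Rightarrow> real" assume f: "convex_on UNIV f"
    show "(\<Sum>i<n. f (\<mu> i - \<theta> * b)) \<le> (\<Sum>i<n. f (\<nu> i - b))"
    proof (rule majorization_pinching[OF S.rows T.rows _ assms(4) _ f])
      fix j l assume "j < n" "l < n"
      then show "(\<Sum>i<n. (\<mu> i - \<theta> * b) * (S.V i j * S.V i l)) =
          (if j = l then 1 else \<theta>) * (\<Sum>k<n. (\<nu> k - b) * (T.V k j * T.V k l))"
        by (simp add: shifted S.spectral_decomposition T.spectral_decomposition S.columns T.columns)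
    qed (use assms(3) in auto)
  qed
qed

text \<open>Separates multiple zeros by arbitrarily small moves: an interval minus finitely many
  points is never empty.\<close>

lemma ex_inj_on_near:
  fixes r :: "nat \<Rightarrow> real"
  assumes "e > 0"
  shows "\<exists>q. inj_on q {..<n} \<and> (\<forall>i<n. \<bar>q i - r i\<bar> < e)"
proof (induction n)
  case (Suc n)
  then obtain q where q: "inj_on q {..<n}" "\<forall>i<n. \<bar>q i - r i\<bar> < e" by blast
  have "infinite ({r n <..< r n + e} - q ` {..<n})"
    using assms by (simp add: infinite_Ioo Diff_infinite_finite)
  then obtain x where x: "x \<in> {r n <..< r n + e} - q ` {..<n}" by (metis finite.emptyI equals0I)
  have "inj_on (q(n := x)) {..<Suc n}"
    using q(1) x by (auto simp: inj_on_def less_Suc_eq)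
  moreover have "\<forall>i<Suc n. \<bar>(q(n := x)) i - r i\<bar> < e"
    using q(2) x by (auto simp: less_Suc_eq)
  ultimately show ?case by blast
qed simp

lemma coeff_tendsto_root_poly:
  assumes "\<And>i. i < n \<Longrightarrow> (\<lambda>k. q k i) \<longlonglongrightarrow> r i"
  shows "coeff_tendsto (\<lambda>k. root_poly n (q k)) (root_poly n r)"
  using assms
proof (induction n)
  case 0
  then show ?case by (simp add: coeff_tendsto_def root_poly_def)
next
  case (Suc n)
  then have "(\<lambda>k. coeff (root_poly n (q k)) i) \<longlonglongrightarrow> coeff (root_poly n r) i" for i
    by (simp add: coeff_tendsto_def)
  moreover have "coeff (root_poly (Suc n) u) i =
      (if i = 0 then 0 else coeff (root_poly n u) (i - 1)) - u n * coeff (root_poly n u) i" for u i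
    by (cases i) (simp_all add: root_poly_Suc)
  ultimately show ?case
    unfolding coeff_tendsto_def using Suc.prems[of n] by (auto intro!: tendsto_intros)
qed

lemma fps_le_lp_factor_scale:
  assumes "b \<noteq> 0" "0 < \<theta>" "\<theta> \<le> 1"
  shows "fps_le (lp_factor (\<theta> * b)) (lp_factor b)"
  unfolding fps_le_def
proof (intro allI ballI)
  fix n P assume "P \<in> hyp_polys n"
  then obtain r where P: "P = root_poly n r" using hyp_polys_imp_root_poly by blast
  have "\<forall>k. \<exists>q. inj_on q {..<n} \<and> (\<forall>i<n. \<bar>q i - r i\<bar> < inverse (real (Suc k)))"
    by (intro allI ex_inj_on_near) simp
  then obtain q where q: "\<And>k. inj_on (q k) {..<n}"
    "\<And>k i. i < n \<Longrightarrow> \<bar>q k i - r i\<bar> < inverse (real (Suc k))" by metis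
  have "(\<lambda>k. q k i) \<longlonglongrightarrow> r i" if "i < n" for i
  proof -
    have "(\<lambda>k. q k i - r i) \<longlonglongrightarrow> 0"
      by (rule Lim_null_comparison[OF _ LIMSEQ_inverse_real_of_nat])
         (use q(2)[OF that] in \<open>auto intro!: always_eventually less_imp_le\<close>)
    then show ?thesis by (simp add: LIM_zero_iff)
  qed
  then have lim: "coeff_tendsto (\<lambda>k. root_poly n (q k)) P"
    unfolding P by (rule coeff_tendsto_root_poly)
  have op: "coeff_tendsto (\<lambda>k. fps_op F (root_poly n (q k))) (fps_op F P)" for F
    by (rule coeff_tendsto_fps_op[OF tendsto_const lim, of n]) (simp add: degree_root_poly)
  show "poly_spectral_le n (fps_op (lp_factor (\<theta> * b)) P) (fps_op (lp_factor b) P)"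
    by (rule poly_spectral_le_limit[OF lp_factor_spectral_le_distinct[OF q(1) assms] op op])
qed

lemma fps_le_lp_factor:
  assumes "\<bar>a\<bar> \<le> \<bar>b\<bar>" "a * b \<ge> 0"
  shows "fps_le (lp_factor a) (lp_factor b)"
proof -
  consider "b = 0" "a = 0" | "b \<noteq> 0" "a = 0" | "b \<noteq> 0" "a \<noteq> 0" using assms(1) by fastforce
  then show ?thesis
  proof cases
    case 1
    then show ?thesis by (simp add: lp_factor_def fps_le_1)
  next
    \<comment> \<open>At parameter 0 there is no secular equation; this value is reached as the
      limit of \<theta> = 1/(k + 1).\<close>
    case 2
    have "(\<lambda>k. inverse (real (Suc k)) * b) \<longlonglongrightarrow> 0 * b"
      by (intro tendsto_intros LIMSEQ_inverse_real_of_nat)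
    then have "(\<lambda>k. fps_nth (lp_factor (inverse (real (Suc k)) * b)) i) \<longlonglongrightarrow> fps_nth (lp_factor a) i" for i
      using 2 by (intro tendsto_fps_nth_lp_factor) simp
    note lim = this
    have "fps_le (lp_factor (inverse (real (Suc k)) * b)) (lp_factor b)" for k
      using 2(1) by (intro fps_le_lp_factor_scale) (auto simp: inverse_le_1_iff)
    from fps_le_limit[OF this lim tendsto_const] show ?thesis .
  next
    case 3
    have "0 < a / b" "a / b \<le> 1"
      using 3 assms by (auto simp: divide_simps zero_less_mult_iff zero_le_mult_iff abs_if split: if_splits)
    from fps_le_lp_factor_scale[OF 3(1) this] 3 show ?thesis by simp
  qed
qed

section \<open>The Gaussian factor\<close>

definition gauss_fps :: "real \<Rightarrow> real fps" where
  "gauss_fps a = fps_exp (- (a\<^sup>2)) oo fps_X\<^sup>2"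

lemma fps_nth_binomial_power:
  fixes c :: real
  shows "fps_nth ((1 + fps_const c * fps_X\<^sup>2) ^ N) i =
    (if even i then of_nat (N choose (i div 2)) * c ^ (i div 2) else 0)"
proof -
  have "(1 + fps_const c * fps_X\<^sup>2) ^ N =
      (\<Sum>k\<le>N. fps_const (of_nat (N choose k) * c ^ k) * (fps_X\<^sup>2) ^ k)"
    unfolding add.commute[of 1] binomial_ring
    by (simp add: power_mult_distrib fps_const_power fps_of_nat[symmetric]
        fps_const_mult[symmetric] mult_ac del: fps_const_mult)
  then have "fps_nth ((1 + fps_const c * fps_X\<^sup>2) ^ N) i =
      (\<Sum>k\<le>N. if i = 2 * k then of_nat (N choose k) * c ^ k else 0)"
    unfolding power_mult[symmetric] by (auto simp: fps_sum_nth fps_X_power_nth intro!: sum.cong)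
  also have "\<dots> = (if even i then of_nat (N choose (i div 2)) * c ^ (i div 2) else 0)"
  proof (cases "even i")
    case True
    then have "(\<Sum>k\<le>N. if i = 2 * k then of_nat (N choose k) * c ^ k else 0) =
        (\<Sum>k\<le>N. if k = i div 2 then of_nat (N choose k) * c ^ k else 0)"
      by (intro sum.cong) auto
    also have "\<dots> = of_nat (N choose (i div 2)) * c ^ (i div 2)"
      by (simp add: not_le binomial_eq_0)
    finally show ?thesis using True by simp
  qed (auto intro!: sum.neutral)
  finally show ?thesis .
qed

text \<open>For fixed j this is a product of j factors c (1 - i/(k + 1)), divided by j factorial,
  and each factor tends to c.\<close>

lemma binomial_power_tendsto:
  fixes c :: real
  shows "(\<lambda>k. of_nat (Suc k choose j) * (c / of_nat (Suc k)) ^ j) \<longlonglongrightarrow> c ^ j / fact j"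
proof -
  have "(\<lambda>k. (\<Prod>i=0..<j. c * (1 - of_nat i * inverse (of_nat (Suc k)))) / fact j) \<longlonglongrightarrow>
      (\<Prod>i=0..<j. c * (1 - of_nat i * 0)) / fact j"
    by (intro tendsto_intros LIMSEQ_inverse_real_of_nat) simp
  moreover have "of_nat (Suc k choose j) * (c / of_nat (Suc k)) ^ j =
      (\<Prod>i=0..<j. c * (1 - of_nat i * inverse (of_nat (Suc k)))) / fact j" for k
  proof -
    have "of_nat (Suc k choose j) * (c / of_nat (Suc k)) ^ j =
        (\<Prod>i=0..<j. of_nat (Suc k) - of_nat i) / fact j * (\<Prod>i=0..<j. c / of_nat (Suc k))"
      unfolding binomial_gbinomial gbinomial_prod_rev by simp
    also have "\<dots> = (\<Prod>i=0..<j. (of_nat (Suc k) - of_nat i) * (c / of_nat (Suc k))) / fact j"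
      by (simp only: prod.distrib times_divide_eq_left)
    also have "(\<Prod>i=0..<j. (of_nat (Suc k) - of_nat i) * (c / of_nat (Suc k))) =
        (\<Prod>i=0..<j. c * (1 - of_nat i * inverse (of_nat (Suc k))))"
      by (intro prod.cong refl) (simp add: field_simps del: of_nat_Suc)
    finally show ?thesis .
  qed
  ultimately show ?thesis by simp
qed

lemma lp_factor_minus: "lp_factor a * lp_factor (- a) = 1 + fps_const (- (a\<^sup>2)) * fps_X\<^sup>2"
proof -
  have "lp_factor a * lp_factor (- a) =
      (1 - fps_const a * fps_X) * (1 - fps_const (- a) * fps_X) * (fps_exp a * fps_exp (- a))"
    by (simp only: lp_factor_def mult_ac)
  also have "fps_exp a * fps_exp (- a) = 1"
    by (simp add: fps_exp_add_mult[symmetric])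
  also have "(1 - fps_const a * fps_X) * (1 - fps_const (- a) * fps_X) * 1 = 1 + fps_const (- (a\<^sup>2)) * fps_X\<^sup>2"
    by (simp add: algebra_simps power2_eq_square fps_const_neg[symmetric] fps_const_mult[symmetric]
        del: fps_const_neg fps_const_mult)
  finally show ?thesis .
qed

text \<open>The square root appears because a pair of factors with opposite parameters contributes
  the square of the parameter, here a^2/(k + 1).\<close>

lemma gauss_fps_limit:
  "(\<lambda>k. fps_nth ((lp_factor (a / sqrt (Suc k)) * lp_factor (- (a / sqrt (Suc k)))) ^ Suc k) i)
     \<longlonglongrightarrow> fps_nth (gauss_fps a) i"
proof (cases "even i")
  case True
  have "(\<lambda>k. of_nat (Suc k choose (i div 2)) * (- (a\<^sup>2) / of_nat (Suc k)) ^ (i div 2))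
      \<longlonglongrightarrow> (- (a\<^sup>2)) ^ (i div 2) / fact (i div 2)"
    by (rule binomial_power_tendsto)
  moreover have "- ((a / sqrt (Suc k))\<^sup>2) = - (a\<^sup>2) / of_nat (Suc k)" for k
    by (simp add: power_divide)
  ultimately show ?thesis
    unfolding lp_factor_minus fps_nth_binomial_power gauss_fps_def fps_nth_compose_X_power
    using True by simp
next
  case False
  then show ?thesis
    unfolding lp_factor_minus fps_nth_binomial_power gauss_fps_def fps_nth_compose_X_power by simp
qed

lemma fps_le_gauss:
  assumes "\<bar>a\<bar> \<le> \<bar>b\<bar>" "a * b \<ge> 0"
  shows "fps_le (gauss_fps a) (gauss_fps b)"
proof (rule fps_le_limit[OF _ gauss_fps_limit gauss_fps_limit])
  fix k
  have 1: "\<bar>a / sqrt (Suc k)\<bar> \<le> \<bar>b / sqrt (Suc k)\<bar>"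
    using assms(1) by (simp add: abs_divide divide_right_mono del: of_nat_Suc)
  have 2: "a / sqrt (Suc k) * (b / sqrt (Suc k)) \<ge> 0"
    using assms(2) by (simp add: divide_nonneg_nonneg del: of_nat_Suc)
  show "fps_le ((lp_factor (a / sqrt (Suc k)) * lp_factor (- (a / sqrt (Suc k)))) ^ Suc k)
      ((lp_factor (b / sqrt (Suc k)) * lp_factor (- (b / sqrt (Suc k)))) ^ Suc k)"
    by (intro fps_le_power fps_le_mult fps_le_lp_factor) (use 1 2 in simp_all)
qed

section \<open>Power series of Laguerre--Polya functions\<close>

text \<open>Analytic expansions live over the complex numbers, the operators over the reals. An
  expansion of the form \<open>complex_fps F\<close> records at once that the Taylor coefficients
  are real.\<close>

definition complex_fps :: "real fps \<Rightarrow> complex fps" where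
  "complex_fps F = Abs_fps (\<lambda>n. of_real (fps_nth F n))"

lemma fps_nth_complex_fps [simp]: "fps_nth (complex_fps F) n = of_real (fps_nth F n)"
  by (simp add: complex_fps_def)

lemma complex_fps_mult: "complex_fps (F * G) = complex_fps F * complex_fps G"
  by (simp add: fps_eq_iff fps_mult_nth)

lemma complex_fps_diff: "complex_fps (F - G) = complex_fps F - complex_fps G"
  by (simp add: fps_eq_iff)

lemma complex_fps_1: "complex_fps 1 = 1"
  by (simp add: fps_eq_iff)

lemma complex_fps_const: "complex_fps (fps_const a) = fps_const (of_real a)"
  by (simp add: fps_eq_iff)

lemma complex_fps_X_power: "complex_fps (fps_X ^ m) = fps_X ^ m"
  by (simp add: fps_eq_iff fps_X_power_nth)

lemma complex_fps_X: "complex_fps fps_X = fps_X"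
  by (simp add: fps_eq_iff)

lemma complex_fps_exp: "complex_fps (fps_exp a) = fps_exp (of_real a)"
  by (simp add: fps_eq_iff)

lemma complex_fps_prod: "complex_fps (prod F A) = (\<Prod>x\<in>A. complex_fps (F x))"
  by (induction A rule: infinite_finite_induct) (simp_all add: complex_fps_1 complex_fps_mult)

lemma complex_fps_gauss: "complex_fps (gauss_fps a) = fps_exp (of_real (- (a\<^sup>2))) oo fps_X\<^sup>2"
  by (simp add: fps_eq_iff gauss_fps_def fps_nth_compose_X_power)

lemma has_fps_expansion_lp_factor:
  "(\<lambda>x. (1 - of_real a * x) * exp (of_real a * x)) has_fps_expansion complex_fps (lp_factor a)"
  unfolding lp_factor_def complex_fps_mult complex_fps_diff complex_fps_1 complex_fps_const
    complex_fps_X complex_fps_exp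
  by (intro has_fps_expansion_mult has_fps_expansion_diff has_fps_expansion_1 has_fps_expansion_exp
      has_fps_expansion_const has_fps_expansion_fps_X)

lemma has_fps_expansion_gauss:
  "(\<lambda>x. exp (- of_real (a\<^sup>2) * x\<^sup>2)) has_fps_expansion complex_fps (gauss_fps a)"
proof -
  have "((\<lambda>x. exp (of_real (- (a\<^sup>2)) * x)) \<circ> (\<lambda>x. x\<^sup>2)) has_fps_expansion
      (fps_exp (of_real (- (a\<^sup>2))) oo fps_X\<^sup>2 :: complex fps)"
    by (intro has_fps_expansion_compose has_fps_expansion_exp has_fps_expansion_fps_X_power)
       (simp add: fps_X_power_nth)
  then show ?thesis by (simp add: complex_fps_gauss o_def)
qed

text \<open>Uniform convergence on a small disc carries over to all derivatives at 0, so the Taylor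
  coefficients of the partial products converge to those of the infinite product.\<close>

lemma lp_product_has_fps_expansion:
  assumes "summable (\<lambda>k. (\<alpha> k)\<^sup>2)"
  obtains G where
    "(\<lambda>x. \<Prod>k. (1 - of_real (\<alpha> k) * x) * exp (of_real (\<alpha> k) * x)) has_fps_expansion complex_fps G"
    "\<And>i. (\<lambda>N. fps_nth (\<Prod>k<N. lp_factor (\<alpha> k)) i) \<longlonglongrightarrow> fps_nth G i"
proof -
  let ?f = "\<lambda>k x :: complex. (1 - of_real (\<alpha> k) * x) * exp (of_real (\<alpha> k) * x)"
  let ?g = "\<lambda>x. \<Prod>k. ?f k x"
  let ?p = "\<lambda>N x. \<Prod>k<N. ?f k x"
  have "(\<lambda>k. sqrt ((\<alpha> k)\<^sup>2)) \<longlonglongrightarrow> sqrt 0"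
    using summable_LIMSEQ_zero[OF assms] by (intro tendsto_intros)
  then have "(\<lambda>k. \<bar>\<alpha> k\<bar>) \<longlonglongrightarrow> 0" by simp
  then have "Bseq \<alpha>"
    by (intro convergent_imp_Bseq) (auto simp: convergent_def tendsto_rabs_zero_iff)
  then obtain B where B: "B > 0" "\<And>k. \<bar>\<alpha> k\<bar> \<le> B" by (auto simp: Bseq_def)
  \<comment> \<open>This radius gives |\<alpha> k x| \<le> 1/2 for all k, the range of the
    Weierstrass factor bound.\<close>
  define r where "r = 1 / (2 * B)"
  have r: "r > 0" using B by (simp add: r_def)
  have bound: "norm (?f k x - 1) \<le> 3 * r\<^sup>2 * (\<alpha> k)\<^sup>2" if "x \<in> cball 0 r" for k x
  proof -
    have x: "norm x \<le> r" using that by simp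
    have "\<bar>\<alpha> k\<bar> * norm x \<le> B * r" using x B by (intro mult_mono) auto
    then have "norm (of_real (\<alpha> k) * x) \<le> 1 / 2" using B by (simp add: norm_mult r_def)
    \<comment> \<open>\<open>?f k x\<close> is the genus 1 Weierstrass factor at \<alpha> k x; it
      differs from 1 only to second order, which matches the square summability of \<alpha>.\<close>
    from weierstrass_factor_bound[OF this, of 1]
    have "norm (?f k x - 1) \<le> 3 * norm (of_real (\<alpha> k) * x) ^ 2"
      by (simp add: weierstrass_factor_def numeral_2_eq_2)
    also have "\<dots> = 3 * ((norm x)\<^sup>2 * (\<alpha> k)\<^sup>2)"
      by (simp add: norm_mult power_mult_distrib)
    also have "\<dots> \<le> 3 * (r\<^sup>2 * (\<alpha> k)\<^sup>2)"
      using x by (intro mult_left_mono mult_right_mono power_mono) auto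
    finally show ?thesis by simp
  qed
  have summ: "summable (\<lambda>k. 3 * r\<^sup>2 * (\<alpha> k)\<^sup>2)" using assms by (rule summable_mult)
  have "uniformly_convergent_on (cball 0 r) (\<lambda>N x. \<Sum>k<N. norm (?f k x - 1))"
    by (rule Weierstrass_m_test'[OF _ summ]) (use bound in simp)
  then have "uniformly_convergent_on (cball 0 r) ?p"
    by (intro uniformly_convergent_on_prod') (auto intro!: continuous_intros)
  then obtain h where h: "uniform_limit (cball 0 r) ?p h sequentially"
    by (auto simp: uniformly_convergent_on_def)
  \<comment> \<open>Uniform convergence yields some limit \<open>h\<close>; pointwise convergence of
    the product identifies it with the infinite product.\<close>
  have hg: "h x = ?g x" if x: "x \<in> cball 0 r" for x
  proof -
    have "summable (\<lambda>k. norm (?f k x - 1))"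
      by (rule summable_comparison_test[OF _ summ]) (use bound[OF x] in auto)
    then have "convergent_prod (\<lambda>k. ?f k x)"
      by (intro abs_convergent_prod_imp_convergent_prod summable_imp_abs_convergent_prod)
    then have "(\<lambda>N. ?p N x) \<longlonglongrightarrow> ?g x"
      using convergent_prod_LIMSEQ by (subst LIMSEQ_lessThan_iff_atMost)
    moreover have "(\<lambda>N. ?p N x) \<longlonglongrightarrow> h x"
      using tendsto_uniform_limitI[OF h x] .
    ultimately show ?thesis by (rule LIMSEQ_unique[symmetric])
  qed
  have ug: "uniform_limit (cball 0 r) ?p ?g sequentially"
    using h hg uniform_limit_cong'[of "cball 0 r" ?p ?p h ?g] by auto
  have ub: "uniform_limit (ball 0 r) ?p ?g sequentially"
    by (rule uniform_limit_on_subset[OF ug ball_subset_cball])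
  have hol: "?p N holomorphic_on A" for N A
    by (intro holomorphic_intros)
  have gh: "?g holomorphic_on ball 0 r"
  proof (rule holomorphic_uniform_sequence[OF open_ball hol])
    fix x :: complex assume "x \<in> ball 0 r"
    then obtain d where "d > 0" "cball x d \<subseteq> ball 0 r" by (meson open_ball open_contains_cball)
    then show "\<exists>d>0. cball x d \<subseteq> ball 0 r \<and> uniform_limit (cball x d) ?p ?g sequentially"
      using uniform_limit_on_subset[OF ub] by blast
  qed
  then have ge: "?g has_fps_expansion fps_expansion ?g 0"
    using r by (intro has_fps_expansion_fps_expansion[of "ball 0 r"]) auto
  have pe: "?p N has_fps_expansion complex_fps (\<Prod>k<N. lp_factor (\<alpha> k))" for N
    unfolding complex_fps_prod by (intro has_fps_expansion_prod has_fps_expansion_lp_factor)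
  have lim: "(\<lambda>N. complex_of_real (fps_nth (\<Prod>k<N. lp_factor (\<alpha> k)) i)) \<longlonglongrightarrow> fps_nth (fps_expansion ?g 0) i" for i
  proof -
    have "(\<lambda>N. (deriv ^^ i) (?p N) 0) \<longlonglongrightarrow> (deriv ^^ i) ?g 0"
      by (rule higher_deriv_complex_uniform_limit[OF ub]) (use r hol in auto)
    then have "(\<lambda>N. (deriv ^^ i) (?p N) 0 / fact i) \<longlonglongrightarrow> (deriv ^^ i) ?g 0 / fact i"
      by (intro tendsto_intros) auto
    then show ?thesis
      unfolding fps_nth_fps_expansion[OF pe, symmetric] fps_nth_fps_expansion[OF ge, symmetric] by simp
  qed
  define G where "G = Abs_fps (\<lambda>i. Re (fps_nth (fps_expansion ?g 0) i))"
  \<comment> \<open>Limits of real coefficients are real.\<close>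
  have "Im (fps_nth (fps_expansion ?g 0) i) = 0" for i
    using tendsto_Im[OF lim[of i]] by (simp add: LIMSEQ_const_iff)
  then have G: "fps_expansion ?g 0 = complex_fps G"
    by (simp add: fps_eq_iff G_def complex_eq_iff)
  show ?thesis
  proof (rule that)
    show "?g has_fps_expansion complex_fps G" using ge G by simp
    show "(\<lambda>N. fps_nth (\<Prod>k<N. lp_factor (\<alpha> k)) i) \<longlonglongrightarrow> fps_nth G i" for i
      using tendsto_Re[OF lim[of i]] by (simp add: G_def)
  qed
qed

lemma lp_fun_has_fps_expansion:
  assumes "summable (\<lambda>k. (\<alpha> (Suc k))\<^sup>2)"
  obtains G where
    "lp_fun m a b c \<alpha> has_fps_expansion
       complex_fps (fps_const c * (fps_X ^ m * (gauss_fps a * fps_exp b * G)))"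
    "\<And>i. (\<lambda>N. fps_nth (\<Prod>k<N. lp_factor (\<alpha> (Suc k))) i) \<longlonglongrightarrow> fps_nth G i"
proof -
  obtain G where G: "(\<lambda>x. \<Prod>k. (1 - of_real (\<alpha> (Suc k)) * x) * exp (of_real (\<alpha> (Suc k)) * x))
      has_fps_expansion complex_fps G"
    "\<And>i. (\<lambda>N. fps_nth (\<Prod>k<N. lp_factor (\<alpha> (Suc k))) i) \<longlonglongrightarrow> fps_nth G i"
    by (rule lp_product_has_fps_expansion[OF assms]) blast
  have eq: "lp_fun m a b c \<alpha> = (\<lambda>x. of_real c * (x ^ m * (exp (- of_real (a\<^sup>2) * x\<^sup>2) * exp (of_real b * x) *
     (\<Prod>k. (1 - of_real (\<alpha> (Suc k)) * x) * exp (of_real (\<alpha> (Suc k)) * x)))))"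
    unfolding lp_fun_def exp_add by (simp add: fun_eq_iff mult_ac)
  have "lp_fun m a b c \<alpha> has_fps_expansion
       complex_fps (fps_const c * (fps_X ^ m * (gauss_fps a * fps_exp b * G)))"
    unfolding eq complex_fps_mult complex_fps_const complex_fps_X_power complex_fps_exp
    by (intro has_fps_expansion_mult has_fps_expansion_const has_fps_expansion_fps_X_power
        has_fps_expansion_gauss has_fps_expansion_exp G(1))
  then show ?thesis using that G(2) by blast
qed

section \<open>Reduction of the normalised operators to power series, and the final
  comparison\<close>

lemma fps_op_smult: "fps_op F (smult a P) = smult a (fps_op F P)"
  using fps_op_mult[of F "fps_const a" P] fps_op_const_mult[of a F P] fps_op_const_mult[of a 1 P]
  by (simp add: fps_op_1 mult.commute)

text \<open>The constant c cancels and x^m becomes an m-fold derivative. What remains is H acting on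
  a real-rooted polynomial that is the same for every deformation.\<close>

lemma norm_diff_op_eq_fps_op:
  assumes \<phi>: "\<phi> has_fps_expansion complex_fps (fps_const c * (fps_X ^ m * H))"
    and H: "fps_nth H 0 = 1" and c: "c \<noteq> 0" and m: "m \<le> n"
  shows "norm_diff_op m \<phi> n P = fps_op H (smult (fact (n - m) / fact n) ((pderiv ^^ m) P))"
proof -
  let ?F = "fps_const c * (fps_X ^ m * H)"
  have "fps_nth (fps_expansion \<phi> 0) k = of_real (fps_nth ?F k)" for k
    using fps_nth_fps_expansion[OF \<phi>, of k] by (simp add: fps_expansion_def)
  then have "diff_op \<phi> P = fps_op ?F P"
    by (simp add: diff_op_def fps_op_def)
  also have "\<dots> = smult c (fps_op H ((pderiv ^^ m) P))"
    by (simp only: fps_op_const_mult mult.commute[of "fps_X ^ m"] fps_op_mult[of H] fps_op_X_power)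
  finally have op: "diff_op \<phi> P = smult c (fps_op H ((pderiv ^^ m) P))" .
  have "(deriv ^^ m) \<phi> 0 / fact m = of_real (fps_nth ?F m)"
    using fps_nth_fps_expansion[OF \<phi>, of m] by simp
  also have "fps_nth ?F m = c"
    by (simp add: fps_X_power_mult_nth H)
  finally have "(deriv ^^ m) \<phi> 0 = of_real (c * fact m)"
    by (simp add: field_simps)
  then have d: "Re ((deriv ^^ m) \<phi> 0) = c * fact m" by (simp only: Re_complex_of_real)
  \<comment> \<open>The m-th derivative at 0 is c times m factorial, and the binomial coefficient
    turns this factorial into n! / (n - m)!.\<close>
  have "inverse (of_nat (n choose m) * (c * fact m)) * c = fact (n - m) / fact n"
    using c by (simp add: binomial_fact[OF m] field_simps)
  then show ?thesis
    by (simp add: norm_diff_op_def op d fps_op_smult)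
qed

lemma summable_deformed:
  assumes "summable (\<lambda>k. (\<alpha> (Suc k))\<^sup>2)" "Bseq s"
  shows "summable (\<lambda>k. (s (Suc k) * \<alpha> (Suc k) :: real)\<^sup>2)"
proof -
  obtain K where K: "K > 0" "\<And>k. \<bar>s k\<bar> \<le> K" using assms(2) by (auto simp: Bseq_def)
  show ?thesis
  proof (rule summable_comparison_test[OF _ summable_mult[OF assms(1), of "K\<^sup>2"]], intro exI allI impI)
    fix k
    have "(s (Suc k))\<^sup>2 \<le> K\<^sup>2" using K by (intro power2_le_iff_abs_le[THEN iffD2]) auto
    then show "norm ((s (Suc k) * \<alpha> (Suc k))\<^sup>2) \<le> K\<^sup>2 * (\<alpha> (Suc k))\<^sup>2"
      by (simp add: power_mult_distrib mult_right_mono)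
  qed
qed

theorem corollary5:
  fixes m n :: nat and \<phi> :: "complex \<Rightarrow> complex"
    and a b c :: real and \<alpha> s t :: "nat \<Rightarrow> real"
  assumes "n \<ge> m + 1"
    and "\<phi> \<in> LP_ord m"
    and "lp_rep m a b c \<alpha> \<phi>"
    and "Bseq s" and "Bseq t"
    and "seq_le s t"
  shows "\<forall>P \<in> hyp_polys n.
    poly_spectral_le (n - m)
      (norm_diff_op m (lp_deform s m a b c \<alpha>) n P)
      (norm_diff_op m (lp_deform t m a b c \<alpha>) n P)"
proof
  fix P assume P: "P \<in> hyp_polys n"
  have c: "c \<noteq> 0" and \<alpha>: "summable (\<lambda>k. (\<alpha> (Suc k))\<^sup>2)"
    using assms(3) by (auto simp: lp_rep_def)
  \<comment> \<open>Both conditions in \<open>seq_le\<close> survive a common real factor x, since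
    the product s i t i only gains x^2. This serves the Gaussian parameter and every \<alpha>
    k.\<close>
  have scaled: "\<bar>s i * x\<bar> \<le> \<bar>t i * x\<bar>" "s i * x * (t i * x) \<ge> 0" for i x
  proof -
    show "\<bar>s i * x\<bar> \<le> \<bar>t i * x\<bar>"
      using assms(6) by (simp add: seq_le_def abs_mult mult_right_mono)
    have "s i * t i * (x * x) \<ge> 0" using assms(6) by (simp add: seq_le_def)
    then show "s i * x * (t i * x) \<ge> 0" by (simp only: mult_ac)
  qed
  let ?p = "\<lambda>s N. \<Prod>k<N. lp_factor (s (Suc k) * \<alpha> (Suc k))"
  obtain S where S: "lp_deform s m a b c \<alpha> has_fps_expansion
      complex_fps (fps_const c * (fps_X ^ m * (gauss_fps (s 0 * a) * fps_exp b * S)))"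
    "\<And>i. (\<lambda>N. fps_nth (?p s N) i) \<longlonglongrightarrow> fps_nth S i"
    unfolding lp_deform_def
    using lp_fun_has_fps_expansion[OF summable_deformed[OF \<alpha> assms(4)]] by blast
  obtain T where T: "lp_deform t m a b c \<alpha> has_fps_expansion
      complex_fps (fps_const c * (fps_X ^ m * (gauss_fps (t 0 * a) * fps_exp b * T)))"
    "\<And>i. (\<lambda>N. fps_nth (?p t N) i) \<longlonglongrightarrow> fps_nth T i"
    unfolding lp_deform_def
    using lp_fun_has_fps_expansion[OF summable_deformed[OF \<alpha> assms(5)]] by blast
  \<comment> \<open>The normalisation relies on constant term 1; every partial product has it, so
    the limits do too.\<close>
  have "fps_nth (?p u N) 0 = 1" for u N
    by (induction N) (simp_all add: fps_nth_lp_factor)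
  then have 0: "fps_nth S 0 = 1" "fps_nth T 0 = 1"
    using S(2)[of 0] T(2)[of 0] by (simp_all add: LIMSEQ_const_iff)
  have g: "fps_nth (gauss_fps x * fps_exp b * H) 0 = 1" if "fps_nth H 0 = 1" for x H
    using that by (simp add: gauss_fps_def)
  \<comment> \<open>Partial products are compared factor by factor before the limit is taken; exp(b
    D) is common to both sides.\<close>
  have "fps_le S T"
    by (rule fps_le_limit[OF _ S(2) T(2)]) (intro fps_le_prod fps_le_lp_factor scaled)
  then have "fps_le (gauss_fps (s 0 * a) * fps_exp b * S) (gauss_fps (t 0 * a) * fps_exp b * T)"
    by (intro fps_le_mult fps_le_gauss fps_le_exp scaled)
  moreover have "smult (fact (n - m) / fact n) ((pderiv ^^ m) P) \<in> hyp_polys (n - m)"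
    using hyp_polys_higher_pderiv[OF P] assms(1) by simp
  ultimately show "poly_spectral_le (n - m)
      (norm_diff_op m (lp_deform s m a b c \<alpha>) n P)
      (norm_diff_op m (lp_deform t m a b c \<alpha>) n P)"
    using norm_diff_op_eq_fps_op[OF S(1) g[OF 0(1)] c, of n P]
      norm_diff_op_eq_fps_op[OF T(1) g[OF 0(2)] c, of n P] assms(1)
    by (simp add: fps_le_def)
qed

end
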